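(* Let $(A,\|\cdot\|)$ be an infinite-dimensional Banach space. Then for every scaling $\mathsf{scl}=(\mathit{scl}_\alpha)_{\alpha>0}$ and for every $\beta\ge\alpha>0$, there exists a compact subset $X\subset A$ (endowed with the metric induced by the norm) such that $$\mathsf{scl}_H X=\alpha\quad\text{and}\quad\mathsf{scl}_P X=\beta.$$ Moreover, there exists a probability measure $\nu$ on $X$ such that for $\nu$-almost every $x\in X$: $$\underline{\mathsf{scl}}_{\mathrm{loc}}\,\nu(x)=\alpha\quad\text{and}\quad\overline{\mathsf{scl}}_{\mathrm{loc}}\,\nu(x)=\beta.$$
   Context: $\mathbb H$ is the set of Hausdorff functions: continuous non-decreasing functions $\phi:[0,\infty)\to[0,\infty)$ with $\phi(0)=0$ and $\phi>0$ on $(0,\infty)$. Hausdorff and packing measures. Let $(X,d)$ be a metric space and $\phi\in\mathbb H$. All balls are open balls $B=B(x,r)$ with center $x\in X$ and prescribed radius $|B|=r>0$. An $\varepsilon$-cover of $X$ is a countable collection of open balls of radii at most $\varepsilon$ whose union contains $X$; an $\varepsilon$-pack of $X$ is a countable collection of pairwise disjoint open balls of $X$ of radii at most $\varepsilon$. Set $\mathcal H^\phi_\varepsilon(X)=\inf\{\sum_{i}\phi(|B_i|):(B_i)_i\text{ an }\varepsilon\text{-cover of }X\}$ and $\mathcal H^\phi(X)=\lim_{\varepsilon\to0}\mathcal H^\phi_\varepsilon(X)$; $\mathcal P^\phi_\varepsilon(X)=\sup\{\sum_{i}\phi(|B_i|):(B_i)_i\text{ an }\varepsilon\text{-pack of }X\}$,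 $\mathcal P^\phi_0(X)=\lim_{\varepsilon\to0}\mathcal P^\phi_\varepsilon(X)$, and $\mathcal P^\phi(X)=\inf\{\sum_{n\ge1}\mathcal P^\phi_0(E_n):X=\bigcup_{n\ge1}E_n\}$. For a subset of a metric space, these quantities are computed by regarding the subset as a metric space with the restricted metric. Scaling. A one-parameter family $\mathsf{scl}=(\mathit{scl}_\alpha)_{\alpha>0}$ of Hausdorff functions is a (continuous) scaling if for every $\beta>\alpha>0$ there exists $\lambda>1$ such that, as $\varepsilon\to0$, $\mathit{scl}_\beta(\varepsilon)=o(\mathit{scl}_\alpha(\varepsilon^\lambda))$ and $\mathit{scl}_\beta(\varepsilon)=o((\mathit{scl}_\alpha(\varepsilon))^\lambda)$. Hausdorff and packing scales of $(X,d)$ (values in $[0,+\infty]$; the sup and inf expressions agree): $\mathsf{scl}_H X=\sup\{\alpha>0:\mathcal H^{\mathit{scl}_\alpha}(X)=+\infty\}=\inf\{\alpha>0:\mathcal H^{\mathit{scl}_\alpha}(X)=0\}$, $\mathsf{scl}_P X=\sup\{\alpha>0:\mathcal P^{\mathit{scl}_\alpha}(X)=+\infty\}=\inf\{\alpha>0:\mathcal P^{\mathit{scl}_\alpha}(X)=0\}$. Densities and local scales. For a Borel measure $\mu$ on $(X,d)$, $\phi\in\mathbb H$ and $x\in X$, $\underline D^\phi_\mu(x)=\liminf_{\varepsilon\to0}\mu(B(x,\varepsilon))/\phi(\varepsilon)$ and $\overline D^\phi_\mu(x)=\limsup_{\varepsilon\to0}\mu(B(x,\varepsilon))/\phi(\varepsilon)$.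 The lower and upper local scales of $\mu$ at $x$ are $\underline{\mathsf{scl}}_{\mathrm{loc}}\,\mu(x)=\sup\{\alpha>0:\overline D^{\mathit{scl}_\alpha}_\mu(x)=0\}$ and $\overline{\mathsf{scl}}_{\mathrm{loc}}\,\mu(x)=\inf\{\alpha>0:\underline D^{\mathit{scl}_\alpha}_\mu(x)=+\infty\}$. Conventions: $\sup\emptyset=0$, $\inf\emptyset=+\infty$. Measures are Borel measures. *)

theory Defs
  imports "HOL-Probability.Probability" "HOL-Library.Landau_Symbols"
begin

definition hausdorff_function :: "(real \<Rightarrow> real) \<Rightarrow> bool" where
  "hausdorff_function \<phi> \<longleftrightarrow>
     continuous_on {0..} \<phi> \<and> mono_on {0..} \<phi> \<and> \<phi> 0 = 0 \<and> (\<forall>r>0. \<phi> r > 0)"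

definition scaling :: "(real \<Rightarrow> real \<Rightarrow> real) \<Rightarrow> bool" where
  "scaling scl \<longleftrightarrow>
     (\<forall>\<alpha>>0. hausdorff_function (scl \<alpha>)) \<and>
     (\<forall>\<alpha> \<beta>. 0 < \<alpha> \<and> \<alpha> < \<beta> \<longrightarrow>
        (\<exists>l>1. scl \<beta> \<in> o[at_right 0](\<lambda>\<epsilon>. scl \<alpha> (\<epsilon> powr l)) \<and>
               scl \<beta> \<in> o[at_right 0](\<lambda>\<epsilon>. scl \<alpha> \<epsilon> powr l)))"

text \<open>
  Below, a set \<open>X\<close> of points is regarded as a metric space with the restricted metric. A ball of
  \<open>X\<close> carries its centre and radius as data: it is a pair \<open>(x, r)\<close> with \<open>x \<in> X\<close> and \<open>r > 0\<close>, and
  its point set is \<open>ball x r \<inter> X\<close>. Countable collections of balls are countable sets of such pairs;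
  repetitions are pointless in a cover and impossible in a pack.
\<close>

definition eps_cover :: "real \<Rightarrow> 'a::metric_space set \<Rightarrow> ('a \<times> real) set \<Rightarrow> bool" where
  "eps_cover \<epsilon> X C \<longleftrightarrow>
     countable C \<and> C \<subseteq> X \<times> {0<..\<epsilon>} \<and> X \<subseteq> (\<Union>(x, r)\<in>C. ball x r \<inter> X)"

definition eps_pack :: "real \<Rightarrow> 'a::metric_space set \<Rightarrow> ('a \<times> real) set \<Rightarrow> bool" where
  "eps_pack \<epsilon> X C \<longleftrightarrow>
     countable C \<and> C \<subseteq> X \<times> {0<..\<epsilon>} \<and> disjoint_family_on (\<lambda>(x, r). ball x r \<inter> X) C"

definition hausdorff_pre :: "(real \<Rightarrow> real) \<Rightarrow> real \<Rightarrow> 'a::metric_space set \<Rightarrow> ennreal" where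
  "hausdorff_pre \<phi> \<epsilon> X = Inf {(\<Sum>\<^sub>\<infinity>(x, r)\<in>C. ennreal (\<phi> r)) | C. eps_cover \<epsilon> X C}"

definition hausdorff_measure :: "(real \<Rightarrow> real) \<Rightarrow> 'a::metric_space set \<Rightarrow> ennreal" where
  "hausdorff_measure \<phi> X = Lim (at_right 0) (\<lambda>\<epsilon>. hausdorff_pre \<phi> \<epsilon> X)"

definition packing_pre :: "(real \<Rightarrow> real) \<Rightarrow> real \<Rightarrow> 'a::metric_space set \<Rightarrow> ennreal" where
  "packing_pre \<phi> \<epsilon> X = Sup {(\<Sum>\<^sub>\<infinity>(x, r)\<in>C. ennreal (\<phi> r)) | C. eps_pack \<epsilon> X C}"

definition packing_pre0 :: "(real \<Rightarrow> real) \<Rightarrow> 'a::metric_space set \<Rightarrow> ennreal" where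
  "packing_pre0 \<phi> X = Lim (at_right 0) (\<lambda>\<epsilon>. packing_pre \<phi> \<epsilon> X)"

definition packing_measure :: "(real \<Rightarrow> real) \<Rightarrow> 'a::metric_space set \<Rightarrow> ennreal" where
  "packing_measure \<phi> X =
     Inf {(\<Sum>n. packing_pre0 \<phi> (E n)) | E :: nat \<Rightarrow> 'a set. X = (\<Union>n. E n)}"

text \<open>
  \<open>Lim\<close> is only meaningful if the limits exist; they do, by monotonicity in \<open>\<epsilon>\<close>.
\<close>

lemma hausdorff_pre_antimono: "\<epsilon> \<le> \<delta> \<Longrightarrow> hausdorff_pre \<phi> \<delta> X \<le> hausdorff_pre \<phi> \<epsilon> X"
  unfolding hausdorff_pre_def eps_cover_def by (rule Inf_superset_mono) force

lemma packing_pre_mono: "\<epsilon> \<le> \<delta> \<Longrightarrow> packing_pre \<phi> \<epsilon> X \<le> packing_pre \<phi> \<delta> X"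
  unfolding packing_pre_def eps_pack_def by (rule Sup_subset_mono) force

lemma hausdorff_pre_tendsto:
  "((\<lambda>\<epsilon>. hausdorff_pre \<phi> \<epsilon> X) \<longlongrightarrow> (SUP \<epsilon>\<in>{0<..}. hausdorff_pre \<phi> \<epsilon> X)) (at_right 0)"
proof (rule order_tendstoI)
  fix a assume "a < (SUP \<epsilon>\<in>{0<..}. hausdorff_pre \<phi> \<epsilon> X)"
  then obtain d :: real where d: "d > 0" "a < hausdorff_pre \<phi> d X"
    by (auto simp: less_SUP_iff)
  show "eventually (\<lambda>\<epsilon>. a < hausdorff_pre \<phi> \<epsilon> X) (at_right 0)"
    using eventually_at_right_less[of "0::real"] eventually_at_right_real[OF d(1)]
    by eventually_elim (rule less_le_trans[OF d(2) hausdorff_pre_antimono], simp)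
next
  fix a assume a: "(SUP \<epsilon>\<in>{0<..}. hausdorff_pre \<phi> \<epsilon> X) < a"
  have "hausdorff_pre \<phi> \<epsilon> X < a" if "\<epsilon> > 0" for \<epsilon>
    by (rule le_less_trans[OF _ a], rule SUP_upper) (use that in simp)
  then show "eventually (\<lambda>\<epsilon>. hausdorff_pre \<phi> \<epsilon> X < a) (at_right 0)"
    by (rule eventually_mono[OF eventually_at_right_less])
qed

lemma packing_pre_tendsto:
  "((\<lambda>\<epsilon>. packing_pre \<phi> \<epsilon> X) \<longlongrightarrow> (INF \<epsilon>\<in>{0<..}. packing_pre \<phi> \<epsilon> X)) (at_right 0)"
proof (rule order_tendstoI)
  fix a assume "(INF \<epsilon>\<in>{0<..}. packing_pre \<phi> \<epsilon> X) < a"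
  then obtain d :: real where d: "d > 0" "packing_pre \<phi> d X < a"
    by (auto simp: INF_less_iff)
  show "eventually (\<lambda>\<epsilon>. packing_pre \<phi> \<epsilon> X < a) (at_right 0)"
    using eventually_at_right_less[of "0::real"] eventually_at_right_real[OF d(1)]
    by eventually_elim (rule le_less_trans[OF packing_pre_mono d(2)], simp)
next
  fix a assume a: "a < (INF \<epsilon>\<in>{0<..}. packing_pre \<phi> \<epsilon> X)"
  have "a < packing_pre \<phi> \<epsilon> X" if "\<epsilon> > 0" for \<epsilon>
    by (rule less_le_trans[OF a], rule INF_lower) (use that in simp)
  then show "eventually (\<lambda>\<epsilon>. a < packing_pre \<phi> \<epsilon> X) (at_right 0)"
    by (rule eventually_mono[OF eventually_at_right_less])
qed

lemma hausdorff_measure_eq_SUP: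
  "hausdorff_measure \<phi> X = (SUP \<epsilon>\<in>{0<..}. hausdorff_pre \<phi> \<epsilon> X)"
  unfolding hausdorff_measure_def by (rule tendsto_Lim[OF _ hausdorff_pre_tendsto]) simp

lemma packing_pre0_eq_INF:
  "packing_pre0 \<phi> X = (INF \<epsilon>\<in>{0<..}. packing_pre \<phi> \<epsilon> X)"
  unfolding packing_pre0_def by (rule tendsto_Lim[OF _ packing_pre_tendsto]) simp

text \<open>
  The scales take values in \<open>ennreal\<close>, where \<open>Sup {} = 0\<close> and \<open>Inf {} = \<infinity>\<close>.
\<close>

definition hausdorff_scale :: "(real \<Rightarrow> real \<Rightarrow> real) \<Rightarrow> 'a::metric_space set \<Rightarrow> ennreal" where
  "hausdorff_scale scl X = Sup {ennreal \<alpha> | \<alpha>. \<alpha> > 0 \<and> hausdorff_measure (scl \<alpha>) X = \<infinity>}"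

definition packing_scale :: "(real \<Rightarrow> real \<Rightarrow> real) \<Rightarrow> 'a::metric_space set \<Rightarrow> ennreal" where
  "packing_scale scl X = Sup {ennreal \<alpha> | \<alpha>. \<alpha> > 0 \<and> packing_measure (scl \<alpha>) X = \<infinity>}"

text \<open>
  The two expressions for each scale agree.
\<close>

lemma scaling_eventually_le:
  assumes "scaling scl" "0 < \<alpha>" "\<alpha> < \<beta>" "c > 0"
  obtains d where "d > 0" "\<And>r. 0 < r \<Longrightarrow> r < d \<Longrightarrow> scl \<beta> r \<le> c * scl \<alpha> r"
proof -
  obtain l where l: "l > 1" "scl \<beta> \<in> o[at_right 0](\<lambda>\<epsilon>. scl \<alpha> (\<epsilon> powr l))"
    using assms unfolding scaling_def by blast
  have \<alpha>: "mono_on {0..} (scl \<alpha>)" "scl \<alpha> 0 = 0"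
    using assms unfolding scaling_def hausdorff_function_def by auto
  obtain d where d: "d > 0" "\<And>r. 0 < r \<Longrightarrow> r < d \<Longrightarrow> \<bar>scl \<beta> r\<bar> \<le> c * \<bar>scl \<alpha> (r powr l)\<bar>"
    using landau_o.smallD[OF l(2) \<open>c > 0\<close>] by (auto simp: eventually_at_right_field)
  show ?thesis
  proof (rule that[of "min d 1"])
    fix r :: real assume r: "0 < r" "r < min d 1"
    have "r powr l \<le> r powr 1"
      using r l by (intro powr_mono') auto
    hence "scl \<alpha> (r powr l) \<le> scl \<alpha> r" "scl \<alpha> 0 \<le> scl \<alpha> (r powr l)"
      using r by (auto intro!: mono_onD[OF \<alpha>(1)])
    hence "\<bar>scl \<alpha> (r powr l)\<bar> \<le> scl \<alpha> r" using \<alpha>(2) by simp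
    hence "c * \<bar>scl \<alpha> (r powr l)\<bar> \<le> c * scl \<alpha> r" using \<open>c > 0\<close> by simp
    thus "scl \<beta> r \<le> c * scl \<alpha> r" using d(2)[of r] r by simp
  qed (use d in auto)
qed

lemma infsum_ennreal_le:
  fixes f g :: "'b \<Rightarrow> ennreal"
  assumes "\<And>p. p \<in> C \<Longrightarrow> f p \<le> ennreal c * g p"
  shows "infsum f C \<le> ennreal c * infsum g C"
proof -
  have "sum f F \<le> ennreal c * infsum g C" if F: "finite F" "F \<subseteq> C" for F
  proof -
    have "sum f F \<le> (\<Sum>p\<in>F. ennreal c * g p)"
      using F by (intro sum_mono assms) auto
    also have "\<dots> = ennreal c * sum g F" by (simp add: sum_distrib_left)
    also have "sum g F \<le> infsum g C"
      using F by (subst nonneg_infsum_complete) (auto intro!: SUP_upper)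
    finally show ?thesis by (simp add: mult_left_mono)
  qed
  thus ?thesis by (subst nonneg_infsum_complete) (auto intro!: SUP_least)
qed

lemma le_cmult_Inf_ennreal:
  fixes a :: ennreal
  assumes "c > 0" "\<And>s. s \<in> S \<Longrightarrow> a \<le> ennreal c * s"
  shows "a \<le> ennreal c * Inf S"
proof -
  have inv: "ennreal (inverse c) * (ennreal c * t) = t" "ennreal c * (ennreal (inverse c) * t) = t" for t
    using \<open>c > 0\<close> by (simp_all add: mult.assoc[symmetric] ennreal_mult'[symmetric])
  have "ennreal (inverse c) * a \<le> Inf S"
  proof (rule Inf_greatest)
    fix s assume "s \<in> S"
    hence "ennreal (inverse c) * a \<le> ennreal (inverse c) * (ennreal c * s)"
      by (intro mult_left_mono assms) auto
    thus "ennreal (inverse c) * a \<le> s" by (simp only: inv)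
  qed
  hence "ennreal c * (ennreal (inverse c) * a) \<le> ennreal c * Inf S" by (intro mult_left_mono) auto
  thus ?thesis by (simp only: inv)
qed

lemma hausdorff_measure_le:
  assumes "scaling scl" "0 < \<alpha>" "\<alpha> < \<beta>" "c > 0"
  shows "hausdorff_measure (scl \<beta>) X \<le> ennreal c * hausdorff_measure (scl \<alpha>) X"
proof -
  obtain d where d: "d > 0" "\<And>r. 0 < r \<Longrightarrow> r < d \<Longrightarrow> scl \<beta> r \<le> c * scl \<alpha> r"
    using scaling_eventually_le[OF assms] by blast
  have "hausdorff_pre (scl \<beta>) \<epsilon> X \<le> ennreal c * hausdorff_measure (scl \<alpha>) X" if "\<epsilon> > 0" for \<epsilon>
  proof -
    define \<delta> where "\<delta> = min \<epsilon> (d / 2)"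
    have \<delta>: "0 < \<delta>" "\<delta> \<le> \<epsilon>" "\<delta> < d" using that d by (auto simp: \<delta>_def)
    have *: "hausdorff_pre (scl \<beta>) \<delta> X \<le> ennreal c * infsum (\<lambda>(x, r). ennreal (scl \<alpha> r)) C"
      if C: "eps_cover \<delta> X C" for C
    proof -
      have "hausdorff_pre (scl \<beta>) \<delta> X \<le> infsum (\<lambda>(x, r). ennreal (scl \<beta> r)) C"
        unfolding hausdorff_pre_def using C by (auto intro!: Inf_lower)
      also have "\<dots> \<le> ennreal c * infsum (\<lambda>(x, r). ennreal (scl \<alpha> r)) C"
      proof (rule infsum_ennreal_le, clarify)
        fix x r assume "(x, r) \<in> C"
        hence "0 < r" "r < d" using C \<delta> unfolding eps_cover_def by force+
        thus "ennreal (scl \<beta> r) \<le> ennreal c * ennreal (scl \<alpha> r)"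
          using d(2)[of r] \<open>c > 0\<close> by (simp add: ennreal_mult'[symmetric] ennreal_leI)
      qed
      finally show ?thesis .
    qed
    have "hausdorff_pre (scl \<beta>) \<epsilon> X \<le> hausdorff_pre (scl \<beta>) \<delta> X"
      by (rule hausdorff_pre_antimono) fact
    also have "\<dots> \<le> ennreal c * hausdorff_pre (scl \<alpha>) \<delta> X"
      unfolding hausdorff_pre_def[of "scl \<alpha>"]
      by (rule le_cmult_Inf_ennreal[OF \<open>c > 0\<close>]) (use * in blast)
    also have "\<dots> \<le> ennreal c * hausdorff_measure (scl \<alpha>) X"
      unfolding hausdorff_measure_eq_SUP using \<delta> by (auto intro!: mult_left_mono SUP_upper)
    finally show ?thesis .
  qed
  thus ?thesis unfolding hausdorff_measure_eq_SUP[of "scl \<beta>"] by (auto intro!: SUP_least)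
qed

lemma packing_pre0_le:
  assumes "scaling scl" "0 < \<alpha>" "\<alpha> < \<beta>" "c > 0"
  shows "packing_pre0 (scl \<beta>) X \<le> ennreal c * packing_pre0 (scl \<alpha>) X"
proof -
  obtain d where d: "d > 0" "\<And>r. 0 < r \<Longrightarrow> r < d \<Longrightarrow> scl \<beta> r \<le> c * scl \<alpha> r"
    using scaling_eventually_le[OF assms] by blast
  have *: "packing_pre (scl \<beta>) \<delta> X \<le> ennreal c * packing_pre (scl \<alpha>) \<delta> X"
    if \<delta>: "0 < \<delta>" "\<delta> < d" for \<delta>
    unfolding packing_pre_def[of "scl \<beta>"]
  proof (rule Sup_least, clarify)
    fix C assume C: "eps_pack \<delta> X C"
    have "infsum (\<lambda>(x, r). ennreal (scl \<beta> r)) C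
            \<le> ennreal c * infsum (\<lambda>(x, r). ennreal (scl \<alpha> r)) C"
    proof (rule infsum_ennreal_le, clarify)
      fix x r assume "(x, r) \<in> C"
      hence "0 < r" "r < d" using C \<delta> unfolding eps_pack_def by force+
      thus "ennreal (scl \<beta> r) \<le> ennreal c * ennreal (scl \<alpha> r)"
        using d(2)[of r] \<open>c > 0\<close> by (simp add: ennreal_mult'[symmetric] ennreal_leI)
    qed
    also have "\<dots> \<le> ennreal c * packing_pre (scl \<alpha>) \<delta> X"
      unfolding packing_pre_def using C by (auto intro!: mult_left_mono Sup_upper)
    finally show "infsum (\<lambda>(x, r). ennreal (scl \<beta> r)) C \<le> ennreal c * packing_pre (scl \<alpha>) \<delta> X" .
  qed
  have lim: "((\<lambda>\<epsilon>. packing_pre \<phi> \<epsilon> X) \<longlongrightarrow> packing_pre0 \<phi> X) (at_right 0)" for \<phi>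
    unfolding packing_pre0_eq_INF by (rule packing_pre_tendsto)
  show ?thesis
  proof (rule tendsto_le[OF _ _ lim])
    show "((\<lambda>\<epsilon>. ennreal c * packing_pre (scl \<alpha>) \<epsilon> X) \<longlongrightarrow> ennreal c * packing_pre0 (scl \<alpha>) X) (at_right 0)"
      by (rule ennreal_tendsto_cmult[OF _ lim]) simp
    show "eventually (\<lambda>\<epsilon>. packing_pre (scl \<beta>) \<epsilon> X \<le> ennreal c * packing_pre (scl \<alpha>) \<epsilon> X) (at_right 0)"
      using * d by (auto simp: eventually_at_right_field)
  qed simp
qed

lemma packing_measure_le:
  assumes "scaling scl" "0 < \<alpha>" "\<alpha> < \<beta>" "c > 0"
  shows "packing_measure (scl \<beta>) X \<le> ennreal c * packing_measure (scl \<alpha>) X"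
proof -
  have *: "packing_measure (scl \<beta>) X \<le> ennreal c * (\<Sum>n. packing_pre0 (scl \<alpha>) (E n))"
    if E: "X = (\<Union>n. E n)" for E :: "nat \<Rightarrow> 'a set"
  proof -
    have "packing_measure (scl \<beta>) X \<le> (\<Sum>n. packing_pre0 (scl \<beta>) (E n))"
      unfolding packing_measure_def using E by (blast intro: Inf_lower)
    also have "\<dots> \<le> (\<Sum>n. ennreal c * packing_pre0 (scl \<alpha>) (E n))"
      by (intro suminf_le packing_pre0_le assms) auto
    also have "\<dots> = ennreal c * (\<Sum>n. packing_pre0 (scl \<alpha>) (E n))" by simp
    finally show ?thesis .
  qed
  thus ?thesis
    unfolding packing_measure_def[of "scl \<alpha>"]
    by (intro le_cmult_Inf_ennreal[OF \<open>c > 0\<close>]) blast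
qed

lemma Sup_top_eq_Inf_zero:
  fixes M :: "real \<Rightarrow> ennreal"
  assumes le: "\<And>\<alpha> \<beta> c. 0 < \<alpha> \<Longrightarrow> \<alpha> < \<beta> \<Longrightarrow> c > 0 \<Longrightarrow> M \<beta> \<le> ennreal c * M \<alpha>"
  shows "Sup {ennreal \<alpha> | \<alpha>. \<alpha> > 0 \<and> M \<alpha> = \<infinity>} = Inf {ennreal \<alpha> | \<alpha>. \<alpha> > 0 \<and> M \<alpha> = 0}"
    (is "Sup ?S = Inf ?I")
proof -
  have zero: "M \<beta> = 0" if "0 < \<alpha>" "\<alpha> < \<beta>" "M \<alpha> \<noteq> \<infinity>" for \<alpha> \<beta>
  proof -
    obtain m where m: "M \<alpha> = ennreal m" "m \<ge> 0" using \<open>M \<alpha> \<noteq> \<infinity>\<close> by (cases "M \<alpha>") auto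
    have eps: "M \<beta> \<le> 0 + ennreal e" if "e > 0" for e
    proof -
      have "M \<beta> \<le> ennreal (e / (m + 1)) * M \<alpha>" using le \<open>0 < \<alpha>\<close> \<open>\<alpha> < \<beta>\<close> that m(2) by simp
      also have "\<dots> = ennreal (e / (m + 1) * m)" using m that by (simp add: ennreal_mult'[symmetric])
      also have "\<dots> \<le> ennreal e" using m that by (intro ennreal_leI) (simp add: field_simps)
      finally show ?thesis by simp
    qed
    have "M \<beta> \<le> 0" by (rule ennreal_le_epsilon) (rule eps)
    thus ?thesis by simp
  qed
  show ?thesis
  proof (rule antisym)
    have "\<alpha> \<le> \<beta>" if "\<alpha> > 0" "M \<alpha> = \<infinity>" "\<beta> > 0" "M \<beta> = 0" for \<alpha> \<beta>
      using zero[of \<beta> \<alpha>] that by force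
    hence "s \<le> t" if "s \<in> ?S" "t \<in> ?I" for s t
      using that by (auto intro!: ennreal_leI)
    thus "Sup ?S \<le> Inf ?I" by (meson Sup_least Inf_greatest)
  next
    show "Inf ?I \<le> Sup ?S"
    proof (rule ccontr)
      assume "\<not> Inf ?I \<le> Sup ?S"
      then obtain u v where uv: "Sup ?S < u" "u < v" "v < Inf ?I"
        by (meson dense not_le)
      have "u \<noteq> 0" using uv(1) by (rule gr_implies_not_zero)
      have "u \<noteq> top" using uv(2) by (rule less_imp_neq[OF less_le_trans]) simp
      have "v \<noteq> top" using uv(3) by (rule less_imp_neq[OF less_le_trans]) simp
      obtain a b where ab: "u = ennreal a" "a \<ge> 0" "v = ennreal b" "b \<ge> 0"
        using \<open>u \<noteq> top\<close> \<open>v \<noteq> top\<close> by (metis ennreal_cases)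
      have a: "a > 0" using \<open>u \<noteq> 0\<close> ab by (cases "a = 0") auto
      have b: "b > a" using uv(2) ab by (simp add: ennreal_less_iff)
      have "M a \<noteq> \<infinity>"
      proof
        assume "M a = \<infinity>"
        hence "ennreal a \<in> ?S" using a by blast
        hence "u \<le> Sup ?S" unfolding ab by (rule Sup_upper)
        thus False using uv(1) by simp
      qed
      hence "M b = 0" using zero a b by blast
      hence "ennreal b \<in> ?I" using a b by force
      hence "Inf ?I \<le> v" unfolding ab by (rule Inf_lower)
      thus False using uv by simp
    qed
  qed
qed

lemma hausdorff_scale_eq_Inf:
  "scaling scl \<Longrightarrow>
     hausdorff_scale scl X = Inf {ennreal \<alpha> | \<alpha>. \<alpha> > 0 \<and> hausdorff_measure (scl \<alpha>) X = 0}"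
  unfolding hausdorff_scale_def by (intro Sup_top_eq_Inf_zero hausdorff_measure_le)

lemma packing_scale_eq_Inf:
  "scaling scl \<Longrightarrow>
     packing_scale scl X = Inf {ennreal \<alpha> | \<alpha>. \<alpha> > 0 \<and> packing_measure (scl \<alpha>) X = 0}"
  unfolding packing_scale_def by (intro Sup_top_eq_Inf_zero packing_measure_le)

text \<open>
  The metric space carrying \<open>\<mu>\<close> is \<open>space \<mu>\<close>, so its balls are \<open>ball x \<epsilon> \<inter> space \<mu>\<close>.
\<close>

definition lower_density ::
    "'a::metric_space measure \<Rightarrow> (real \<Rightarrow> real) \<Rightarrow> 'a \<Rightarrow> ennreal" where
  "lower_density \<mu> \<phi> x =
     Liminf (at_right 0) (\<lambda>\<epsilon>. emeasure \<mu> (ball x \<epsilon> \<inter> space \<mu>) / ennreal (\<phi> \<epsilon>))"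

definition upper_density ::
    "'a::metric_space measure \<Rightarrow> (real \<Rightarrow> real) \<Rightarrow> 'a \<Rightarrow> ennreal" where
  "upper_density \<mu> \<phi> x =
     Limsup (at_right 0) (\<lambda>\<epsilon>. emeasure \<mu> (ball x \<epsilon> \<inter> space \<mu>) / ennreal (\<phi> \<epsilon>))"

definition lower_local_scale ::
    "(real \<Rightarrow> real \<Rightarrow> real) \<Rightarrow> 'a::metric_space measure \<Rightarrow> 'a \<Rightarrow> ennreal" where
  "lower_local_scale scl \<mu> x = Sup {ennreal \<alpha> | \<alpha>. \<alpha> > 0 \<and> upper_density \<mu> (scl \<alpha>) x = 0}"

definition upper_local_scale ::
    "(real \<Rightarrow> real \<Rightarrow> real) \<Rightarrow> 'a::metric_space measure \<Rightarrow> 'a \<Rightarrow> ennreal" where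
  "upper_local_scale scl \<mu> x = Inf {ennreal \<alpha> | \<alpha>. \<alpha> > 0 \<and> lower_density \<mu> (scl \<alpha>) x = \<infinity>}"

end

theory Submission
  imports Defs
begin

text \<open>
  Riesz's lemma gives unit vectors \<open>e\<^sub>0, e\<^sub>1, \<dots>\<close> of the Banach space that are pairwise at distance
  at least \<open>1/2\<close>. For radii \<open>r\<^sub>k\<close> with \<open>r\<^bsub>k+1\<^esub> \<le> r\<^sub>k / 100\<close> and branching numbers \<open>n\<^sub>k \<ge> 1\<close>, let
  \<open>X\<close> be the set of all sums \<open>\<Sum>\<^sub>k r\<^sub>k e(i\<^sub>k)\<close> with digits \<open>i\<^sub>k < n\<^sub>k\<close>, and let \<open>\<nu>\<close> be the law of
  this sum for independent uniform digits. The set \<open>X\<close> is a continuous image of a compact product.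
  Two points that agree in their first \<open>k\<close> digits are at distance less than \<open>3 r\<^sub>k\<close>, and two points
  at distance less than \<open>r\<^sub>k / 4\<close> agree in their first \<open>k + 1\<close> digits. With
  \<open>N\<^sub>k = n\<^sub>0 \<cdots> n\<^bsub>k-1\<^esub>\<close> this means that, for every \<open>x \<in> X\<close>,
  \<open>\<nu>(B(x, \<epsilon>)) \<ge> 1/N\<^sub>k\<close> if \<open>\<epsilon> \<ge> 3 r\<^sub>k\<close>, and \<open>\<nu>(B(x, \<epsilon>)) \<le> 1/N\<^bsub>k+1\<^esub>\<close> if \<open>\<epsilon> \<le> r\<^sub>k / 4\<close>
  (lemmas \<open>cantor_mass_ge\<close> and \<open>cantor_mass_le\<close>).

  The parameters are chosen recursively so that \<open>1/N\<^bsub>k+1\<^esub>\<close> is essentially equal to both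
  \<open>scl\<^sub>\<beta>(r\<^sub>k)\<close> and \<open>scl\<^sub>\<alpha>(r\<^bsub>k+1\<^esub>)\<close>; the four estimates in lemma \<open>cantor_parameters\<close>
  say what this means. Constant factors, both of the value and of the argument of \<open>scl\<close>, are
  absorbed by an arbitrarily small change of the index (lemma \<open>scaling_dilate\<close>). Hence \<open>\<nu>(B(x, \<epsilon>))\<close> lies between \<open>scl\<^sub>\<gamma>(\<epsilon>)\<close> with \<open>\<gamma> > \<beta>\<close> and
  with \<open>\<gamma> < \<alpha>\<close> for all small \<open>\<epsilon>\<close>, and along suitable sequences \<open>\<epsilon> \<rightarrow> 0\<close> it is at least
  \<open>scl\<^sub>\<gamma>(\<epsilon>)\<close> for \<open>\<gamma> > \<alpha>\<close>, respectively at most \<open>scl\<^sub>\<gamma>(\<epsilon>)\<close> for \<open>\<gamma> < \<beta>\<close>; all this uniformly in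
  \<open>x\<close>.

  These four uniform estimates (locale \<open>uniform_local_scales\<close>) determine all the scales. The local
  scales are immediate. For \<open>\<gamma> < \<alpha>\<close> the mass distribution principle gives
  \<open>\<H>\<^sup>\<gamma>(X) \<ge> 1\<close>; for \<open>\<gamma> > \<beta>\<close> the disjoint balls of a pack have total mass at most \<open>1\<close>, so
  \<open>\<P>\<^sup>\<gamma>(X) \<le> 1\<close>. The other two bounds come from a maximal separated set at one good radius: it
  yields a cover for \<open>\<gamma> > \<alpha>\<close>, and, for \<open>\<gamma> < \<beta>\<close>, a pack of any \<open>E \<subseteq> X\<close> whose sum is at least
  the outer measure of \<open>E\<close>, which countable subadditivity turns into \<open>\<P>\<^sup>\<gamma>(X) \<ge> 1\<close>.
\<close>


section \<open>Separated unit vectors in infinite-dimensional normed spaces\<close>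

text \<open>
  By induction on the generators: the coefficient of a new generator \<open>b\<close> is controlled by the norm,
  because \<open>b\<close> has positive distance to the span of the others, which is closed.
\<close>

lemma complete_span_finite:
  fixes B :: "'a::real_normed_vector set"
  assumes "finite B"
  shows "Topological_Spaces.complete (span B)"
  using assms
proof (induction B)
  case empty
  then show ?case by (simp add: compact_imp_complete)
next
  case (insert b B)
  show ?case
  proof (cases "b \<in> span B")
    case True
    then show ?thesis using insert.IH by (simp add: span_redundant)
  next
    case False
    define d where "d = infdist b (span B)"
    have ne: "span B \<noteq> {}" using span_zero by blast
    have "closed (span B)" using insert.IH by (rule complete_imp_closed)
    hence d: "d > 0"
      using False ne in_closed_iff_infdist_zero[of "span B" b] infdist_nonneg[of b "span B"]
      unfolding d_def by force
    have coeff: "\<bar>c\<bar> * d \<le> norm (c *\<^sub>R b + v)" if "v \<in> span B" for c v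
    proof (cases "c = 0")
      case False
      have "- (1 / c) *\<^sub>R v \<in> span B" using that by (intro span_scale)
      hence "d \<le> dist b (- (1 / c) *\<^sub>R v)" unfolding d_def by (rule infdist_le)
      also have "\<dots> = norm (b + (1 / c) *\<^sub>R v)" by (simp add: dist_norm)
      finally have "\<bar>c\<bar> * d \<le> \<bar>c\<bar> * norm (b + (1 / c) *\<^sub>R v)"
        by (intro mult_left_mono) auto
      also have "\<dots> = norm (c *\<^sub>R (b + (1 / c) *\<^sub>R v))" by simp
      also have "c *\<^sub>R (b + (1 / c) *\<^sub>R v) = c *\<^sub>R b + v"
        using False by (simp add: scaleR_add_right)
      finally show ?thesis .
    qed auto
    show ?thesis unfolding Real_Vector_Spaces.complete_def
    proof (intro allI impI, elim conjE)
      fix f :: "nat \<Rightarrow> 'a"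
      assume f: "\<forall>n. f n \<in> span (insert b B)" and cf: "Cauchy f"
      have "\<forall>n. \<exists>k. f n - k *\<^sub>R b \<in> span B" using f unfolding span_insert by blast
      then obtain a where a: "\<And>n. f n - a n *\<^sub>R b \<in> span B" by metis
      have "Cauchy a" unfolding Cauchy_def
      proof (intro allI impI)
        fix e :: real assume "e > 0"
        hence "e * d > 0" using d by simp
        then obtain N where N: "\<And>m n. m \<ge> N \<Longrightarrow> n \<ge> N \<Longrightarrow> dist (f m) (f n) < e * d"
          using cf unfolding Cauchy_def by meson
        have "dist (a m) (a n) < e" if "m \<ge> N" "n \<ge> N" for m n
        proof -
          have "(f m - a m *\<^sub>R b) - (f n - a n *\<^sub>R b) \<in> span B" by (intro span_diff a)
          from coeff[OF this, of "a m - a n"]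
          have "\<bar>a m - a n\<bar> * d \<le> dist (f m) (f n)"
            by (simp add: algebra_simps dist_norm)
          also have "\<dots> < e * d" using N that by blast
          finally show ?thesis using d by (simp add: dist_real_def)
        qed
        thus "\<exists>M. \<forall>m\<ge>M. \<forall>n\<ge>M. dist (a m) (a n) < e" by blast
      qed
      then obtain a0 where a0: "a \<longlonglongrightarrow> a0" using Cauchy_convergent_iff convergent_def by blast
      have "Cauchy (\<lambda>n. f n - a n *\<^sub>R b)" unfolding Cauchy_def
      proof (intro allI impI)
        fix \<epsilon> :: real assume "\<epsilon> > 0"
        have "Cauchy (\<lambda>n. a n *\<^sub>R b)"
          by (rule LIMSEQ_imp_Cauchy[of _ "a0 *\<^sub>R b"]) (intro tendsto_intros a0)
        then obtain M where M: "\<And>m n. m \<ge> M \<Longrightarrow> n \<ge> M \<Longrightarrow> dist (a m *\<^sub>R b) (a n *\<^sub>R b) < \<epsilon> / 2"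
          using \<open>\<epsilon> > 0\<close> unfolding Cauchy_def by (meson half_gt_zero)
        obtain N where N: "\<And>m n. m \<ge> N \<Longrightarrow> n \<ge> N \<Longrightarrow> dist (f m) (f n) < \<epsilon> / 2"
          using cf \<open>\<epsilon> > 0\<close> unfolding Cauchy_def by (meson half_gt_zero)
        have "dist (f m - a m *\<^sub>R b) (f n - a n *\<^sub>R b) < \<epsilon>" if "m \<ge> max M N" "n \<ge> max M N" for m n
          using dist_triangle_add[of "f m" "- (a m *\<^sub>R b)" "f n" "- (a n *\<^sub>R b)"] M[of m n] N[of m n] that
          by (simp add: dist_minus)
        thus "\<exists>K. \<forall>m\<ge>K. \<forall>n\<ge>K. dist (f m - a m *\<^sub>R b) (f n - a n *\<^sub>R b) < \<epsilon>" by blast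
      qed
      then obtain v where v: "v \<in> span B" "(\<lambda>n. f n - a n *\<^sub>R b) \<longlonglongrightarrow> v"
        using insert.IH a unfolding Real_Vector_Spaces.complete_def by meson
      have "(\<lambda>n. (f n - a n *\<^sub>R b) + a n *\<^sub>R b) \<longlonglongrightarrow> v + a0 *\<^sub>R b"
        by (intro tendsto_intros a0 v)
      hence "f \<longlonglongrightarrow> v + a0 *\<^sub>R b" by simp
      moreover have "v + a0 *\<^sub>R b \<in> span (insert b B)"
        unfolding span_insert using v by (auto intro: exI[of _ a0])
      ultimately show "\<exists>l\<in>span (insert b B). f \<longlonglongrightarrow> l" by blast
    qed
  qed
qed

text \<open>Riesz's lemma with constant \<open>1/2\<close>.\<close>

lemma riesz_half:
  fixes B :: "'a::real_normed_vector set"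
  assumes "finite B" "span B \<noteq> UNIV"
  obtains u where "norm u = 1" "\<And>v. v \<in> span B \<Longrightarrow> norm (u - v) \<ge> 1 / 2"
proof -
  obtain x where x: "x \<notin> span B" using assms by blast
  define d where "d = infdist x (span B)"
  have ne: "span B \<noteq> {}" using span_zero by blast
  have "closed (span B)" using complete_span_finite[OF assms(1)] by (rule complete_imp_closed)
  hence d: "d > 0"
    using x ne in_closed_iff_infdist_zero[of "span B" x] infdist_nonneg[of x "span B"]
    unfolding d_def by force
  have "\<exists>y\<in>span B. dist x y < 2 * d"
  proof (rule ccontr)
    assume "\<not> ?thesis"
    hence "2 * d \<le> d"
      unfolding d_def infdist_notempty[OF ne] using ne by (intro cINF_greatest) auto
    thus False using d by simp
  qed
  then obtain y where y: "y \<in> span B" "dist x y < 2 * d" by blast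
  define t where "t = norm (x - y)"
  have "d \<le> t" unfolding d_def t_def using infdist_le[OF y(1), of x] by (simp add: dist_norm)
  hence t: "t > 0" "t < 2 * d" using d y by (auto simp: t_def dist_norm)
  show ?thesis
  proof (rule that[of "(1 / t) *\<^sub>R (x - y)"])
    show "norm ((1 / t) *\<^sub>R (x - y)) = 1" using t by (simp add: t_def)
    fix v assume v: "v \<in> span B"
    \<comment> \<open>\<open>y + t v\<close> lies in the span, so its distance to \<open>x\<close> is at least \<open>d > t / 2\<close>\<close>
    have "d \<le> norm (x - (y + t *\<^sub>R v))"
      unfolding d_def dist_norm[symmetric] using v y by (intro infdist_le span_add span_scale)
    also have "x - (y + t *\<^sub>R v) = t *\<^sub>R ((1 / t) *\<^sub>R (x - y) - v)"
      using t by (simp add: scaleR_diff_right algebra_simps)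
    also have "norm \<dots> = t * norm ((1 / t) *\<^sub>R (x - y) - v)" using t by simp
    finally have "t * (1 / 2) \<le> t * norm ((1 / t) *\<^sub>R (x - y) - v)" using t by linarith
    thus "norm ((1 / t) *\<^sub>R (x - y) - v) \<ge> 1 / 2" using t by (simp only: mult_le_cancel_left_pos)
  qed
qed

lemma separated_unit_sequence:
  assumes "\<not> (\<exists>B :: 'a::real_normed_vector set. finite B \<and> span B = UNIV)"
  obtains e :: "nat \<Rightarrow> 'a::real_normed_vector"
  where "\<And>n. norm (e n) = 1" "\<And>m n. m \<noteq> n \<Longrightarrow> 1 / 2 \<le> norm (e m - e n)"
proof -
  have "\<exists>e :: nat \<Rightarrow> 'a. \<forall>n. norm (e n) = 1 \<and> (\<forall>m<n. 1 / 2 \<le> norm (e n - e m))"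
  proof (rule dependent_wellorder_choice)
    fix n and e :: "nat \<Rightarrow> 'a"
    have "span (e ` {..<n}) \<noteq> UNIV" using assms by blast
    then obtain u where "norm u = 1" "\<And>v. v \<in> span (e ` {..<n}) \<Longrightarrow> norm (u - v) \<ge> 1 / 2"
      using riesz_half[of "e ` {..<n}"] by blast
    thus "\<exists>u. norm u = 1 \<and> (\<forall>m<n. 1 / 2 \<le> norm (u - e m))" by (auto intro: span_base)
  qed auto
  then obtain e :: "nat \<Rightarrow> 'a"
    where e: "\<And>n. norm (e n) = 1" "\<And>m n. m < n \<Longrightarrow> 1 / 2 \<le> norm (e n - e m)" by blast
  show ?thesis
  proof (rule that[of e])
    fix m n :: nat assume "m \<noteq> n"
    thus "1 / 2 \<le> norm (e m - e n)"
      using e(2)[of m n] e(2)[of n m] by (cases m n rule: linorder_cases) (auto simp: norm_minus_commute)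
  qed (rule e)
qed


section \<open>Scalings and the choice of radii and branching numbers\<close>

lemma hausdorff_functionD:
  assumes "hausdorff_function \<phi>"
  shows "continuous_on {0..} \<phi>" "\<And>r s. 0 \<le> r \<Longrightarrow> r \<le> s \<Longrightarrow> \<phi> r \<le> \<phi> s" "\<phi> 0 = 0"
    "\<And>r. 0 < r \<Longrightarrow> 0 < \<phi> r"
  using assms unfolding hausdorff_function_def by (auto simp: mono_on_def)

lemma scaling_hausdorff_function: "scaling scl \<Longrightarrow> 0 < \<gamma> \<Longrightarrow> hausdorff_function (scl \<gamma>)"
  by (auto simp: scaling_def)

text \<open>
  An increase of the index absorbs any constant factors, in the argument and in the value. In the
  argument, this holds because \<open>(K r) powr l \<le> L r\<close> for small \<open>r\<close> when \<open>l > 1\<close>.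
\<close>

lemma scaling_dilate:
  assumes "scaling scl" "0 < \<gamma>" "\<gamma> < \<gamma>'" "0 < K" "0 < L" "0 < c"
  shows "\<forall>\<^sub>F r in at_right 0. scl \<gamma>' (K * r) \<le> c * scl \<gamma> (L * r)"
proof -
  obtain l where l: "l > 1" "scl \<gamma>' \<in> o[at_right 0](\<lambda>\<epsilon>. scl \<gamma> (\<epsilon> powr l))"
    using assms(1-3) unfolding scaling_def by blast
  have lim: "filterlim (\<lambda>r. K * r) (at_right 0) (at_right 0)"
    unfolding filterlim_at using \<open>0 < K\<close>
    by (auto intro!: tendsto_eq_intros eventually_mono[OF eventually_at_right_less])
  have "\<forall>\<^sub>F s in at_right 0. \<bar>scl \<gamma>' s\<bar> \<le> c * \<bar>scl \<gamma> (s powr l)\<bar>"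
    using landau_o.smallD[OF l(2) \<open>c > 0\<close>] by simp
  hence 1: "\<forall>\<^sub>F r in at_right 0. \<bar>scl \<gamma>' (K * r)\<bar> \<le> c * \<bar>scl \<gamma> ((K * r) powr l)\<bar>"
    by (rule eventually_compose_filterlim[OF _ lim])
  have "((\<lambda>r. K powr l * r powr (l - 1)) \<longlongrightarrow> K powr l * 0) (at_right 0)"
    using l by (intro tendsto_intros tendsto_zero_powrI[where b = "l - 1"])
      (auto intro!: eventually_mono[OF eventually_at_right_less])
  hence 2: "\<forall>\<^sub>F r in at_right 0. K powr l * r powr (l - 1) < L"
    using \<open>0 < L\<close> by (auto dest!: order_tendstoD(2)[where a = L])
  show ?thesis using 1 2 eventually_at_right_less[of 0]
  proof eventually_elim
    case (elim r)
    have "(K * r) powr l = (K powr l * r powr (l - 1)) * r"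
      using elim \<open>0 < K\<close> l by (simp add: powr_mult powr_diff)
    also have "\<dots> \<le> L * r" using elim by (intro mult_right_mono) auto
    finally have le: "(K * r) powr l \<le> L * r" .
    have hf: "hausdorff_function (scl \<gamma>)" using assms by (intro scaling_hausdorff_function)
    have "\<bar>scl \<gamma> ((K * r) powr l)\<bar> \<le> scl \<gamma> (L * r)"
      using hausdorff_functionD(2)[OF hf _ le] hausdorff_functionD(2)[OF hf, of 0 "(K * r) powr l"]
        hausdorff_functionD(3)[OF hf] by simp
    hence "c * \<bar>scl \<gamma> ((K * r) powr l)\<bar> \<le> c * scl \<gamma> (L * r)" using \<open>0 < c\<close> by simp
    thus ?case using elim by linarith
  qed
qed

text \<open>
  Either the value \<open>c\<close> is attained on \<open>(0, s]\<close>, or \<open>\<phi>\<close> does not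
  exceed \<open>c\<close> at the endpoint \<open>s\<close>.
\<close>

lemma hausdorff_function_attains:
  assumes "hausdorff_function \<phi>" "0 < c" "0 < s"
  obtains r where "0 < r" "r \<le> s" "\<phi> r \<le> c" "\<phi> r = c \<or> r = s"
proof (cases "\<phi> s \<le> c")
  case False
  have "\<exists>x\<ge>0. x \<le> s \<and> \<phi> x = c"
    using False assms hausdorff_functionD[OF assms(1)]
    by (intro IVT') (auto intro: continuous_on_subset)
  then obtain x where "0 \<le> x" "x \<le> s" "\<phi> x = c" by blast
  thus ?thesis using assms(2) hausdorff_functionD(3)[OF assms(1)]
    by (intro that[of x]) (auto simp: order_le_less)
qed (use assms that in auto)

text \<open>
  Rounding: some positive multiple of \<open>N\<close> is comparable to \<open>1/a\<close>, unless \<open>N\<close> is already larger than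
  \<open>1/a\<close>, in which case \<open>m = 1\<close> is taken.
\<close>

lemma multiple_near:
  fixes a N :: real
  assumes "0 < a" "0 < N"
  obtains m :: nat where "m \<ge> 1" "1 / (N * m) \<le> a" "min (1 / N) (a / 2) \<le> 1 / (N * m)"
proof -
  define t where "t = 1 / (a * N)"
  define m where "m = nat \<lceil>t\<rceil>"
  have t: "t > 0" using assms by (simp add: t_def)
  have m: "m \<ge> 1" "t \<le> m" "m < t + 1"
    unfolding m_def using t by linarith+
  have "1 \<le> a * (N * m)" using m(2) assms by (simp add: t_def field_simps)
  hence 1: "1 / (N * m) \<le> a" using m assms by (simp add: field_simps)
  have "min (1 / N) (a / 2) \<le> 1 / (N * m)"
  proof (cases "m = 1")
    case False
    hence "m \<ge> 2" using m by linarith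
    hence "m \<le> 2 * t" using m by linarith
    hence "a * N * m \<le> 2" using assms by (simp add: t_def field_simps)
    hence "a / 2 \<le> 1 / (N * m)" using assms m by (simp add: field_simps)
    thus ?thesis by linarith
  qed simp
  thus ?thesis using that m 1 by blast
qed

text \<open>
  Here \<open>\<Prod>i<k. n i\<close> is the number \<open>N\<^sub>k\<close> of cylinders of level \<open>k\<close>. The recursion keeps
  \<open>scl\<^sub>\<alpha>(r\<^sub>k) \<le> 1/N\<^sub>k\<close>. Given \<open>r\<^sub>k\<close>, the number \<open>N\<^bsub>k+1\<^esub>\<close> is a multiple of \<open>N\<^sub>k\<close> close to
  \<open>1/scl\<^sub>\<beta>(r\<^sub>k)\<close>, and then \<open>r\<^bsub>k+1\<^esub> \<le> r\<^sub>k / 100\<close> solves \<open>scl\<^sub>\<alpha>(r\<^bsub>k+1\<^esub>) = 1/N\<^bsub>k+1\<^esub>\<close>, unless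
  \<open>r\<^bsub>k+1\<^esub> = r\<^sub>k / 100\<close> already satisfies the invariant. In the latter case
  \<open>1/N\<^bsub>k+1\<^esub> \<le> scl\<^sub>\<beta>(100 r\<^bsub>k+1\<^esub>)\<close>, which serves as well as the equation since \<open>\<alpha> \<le> \<beta>\<close>; this
  is what allows \<open>\<alpha> = \<beta>\<close>, where the equation alone would not make the radii decrease.
\<close>

lemma cantor_parameters:
  fixes scl :: "real \<Rightarrow> real \<Rightarrow> real"
  assumes scl: "scaling scl" and "0 < \<alpha>" "\<alpha> \<le> \<beta>"
  obtains r :: "nat \<Rightarrow> real" and n :: "nat \<Rightarrow> nat"
  where "\<And>k. 0 < r k" "\<And>k. r (Suc k) \<le> r k / 100" "\<And>k. 1 \<le> n k"
    "\<And>\<gamma>. 0 < \<gamma> \<Longrightarrow> \<gamma> < \<alpha> \<Longrightarrow> \<forall>\<^sub>F k in sequentially. 1 / (\<Prod>i<k. real (n i)) \<le> scl \<gamma> (r k / 4)"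
    "\<And>\<gamma>. \<alpha> < \<gamma> \<Longrightarrow> \<forall>\<^sub>F k in sequentially. scl \<gamma> (3 * r k) \<le> 1 / (\<Prod>i<k. real (n i))"
    "\<And>\<gamma>. \<beta> < \<gamma> \<Longrightarrow> \<forall>\<^sub>F k in sequentially. scl \<gamma> (3 * r k) \<le> 1 / (\<Prod>i<Suc k. real (n i))"
    "\<And>\<gamma>. 0 < \<gamma> \<Longrightarrow> \<gamma> < \<beta> \<Longrightarrow>
       \<forall>\<^sub>F k in sequentially. 1 / (\<Prod>i<Suc k. real (n i)) \<le> scl \<gamma> (r k / 4)"
proof -
  have "0 < \<beta>" using assms by simp
  have hf: "hausdorff_function (scl \<alpha>)" "hausdorff_function (scl \<beta>)"
    using scl \<open>0 < \<alpha>\<close> \<open>0 < \<beta>\<close> by (auto intro: scaling_hausdorff_function)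
  define P :: "real \<times> nat \<Rightarrow> bool" where
    "P = (\<lambda>(s, N). 0 < s \<and> 0 < N \<and> scl \<alpha> s \<le> 1 / N)"
  define Q :: "real \<times> nat \<Rightarrow> real \<times> nat \<Rightarrow> bool" where
    "Q = (\<lambda>(s, N) (s', N'). (\<exists>m::nat. m \<ge> 1 \<and> N' = N * m) \<and> s' \<le> s / 100 \<and>
       (scl \<alpha> s' = 1 / N' \<or> s' = s / 100) \<and>
       1 / N' \<le> scl \<beta> s \<and> min (1 / N) (scl \<beta> s / 2) \<le> 1 / N')"
  have "\<exists>f. \<forall>k. (P (f k) \<and> (k = 0 \<longrightarrow> snd (f k) = 1)) \<and> Q (f k) (f (Suc k))"
  proof (rule dependent_nat_choice)
    obtain s where "0 < s" "scl \<alpha> s \<le> 1"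
      using hausdorff_function_attains[OF hf(1), of 1 1] by auto
    thus "\<exists>x. P x \<and> ((0::nat) = 0 \<longrightarrow> snd x = 1)" by (intro exI[of _ "(s, 1)"]) (simp add: P_def)
  next
    fix x :: "real \<times> nat" and k :: nat assume "P x \<and> (k = 0 \<longrightarrow> snd x = 1)"
    then obtain s N where x: "x = (s, N)" and s: "0 < s" "0 < N" "scl \<alpha> s \<le> 1 / N"
      by (cases x) (auto simp: P_def)
    obtain m :: nat where m: "m \<ge> 1" "1 / (real N * m) \<le> scl \<beta> s"
      "min (1 / N) (scl \<beta> s / 2) \<le> 1 / (real N * m)"
      using multiple_near[of "scl \<beta> s" "real N"] hausdorff_functionD(4)[OF hf(2)] s by auto
    obtain s' where "0 < s'" "s' \<le> s / 100" "scl \<alpha> s' \<le> 1 / (real N * m)"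
      "scl \<alpha> s' = 1 / (real N * m) \<or> s' = s / 100"
      using hausdorff_function_attains[OF hf(1), of "1 / (real N * m)" "s / 100"] s m by auto
    thus "\<exists>y. (P y \<and> (Suc k = 0 \<longrightarrow> snd y = 1)) \<and> Q x y"
      using s m unfolding x by (intro exI[of _ "(s', N * m)"]) (auto simp: P_def Q_def)
  qed
  then obtain f where f: "\<And>k. P (f k)" "snd (f 0) = 1" "\<And>k. Q (f k) (f (Suc k))" by blast
  define r N where "r = (\<lambda>k. fst (f k))" and "N = (\<lambda>k. snd (f k))"
  have fk: "f k = (r k, N k)" for k by (simp add: r_def N_def)
  have r: "0 < r k" and N: "0 < N k" and A1: "scl \<alpha> (r k) \<le> 1 / N k" for k
    using f(1)[of k] by (auto simp: fk P_def)
  have "\<exists>m::nat. m \<ge> 1 \<and> N (Suc k) = N k * m"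
    and rS: "r (Suc k) \<le> r k / 100"
    and A2: "scl \<alpha> (r (Suc k)) = 1 / N (Suc k) \<or> r (Suc k) = r k / 100"
    and A3: "1 / N (Suc k) \<le> scl \<beta> (r k)"
    and A4: "min (1 / N k) (scl \<beta> (r k) / 2) \<le> 1 / N (Suc k)" for k
    using f(3)[of k] by (auto simp: fk Q_def)
  then obtain n where n: "\<And>k. n k \<ge> 1" "\<And>k. N (Suc k) = N k * n k" by metis
  have N_prod: "real (N k) = (\<Prod>i<k. real (n i))" for k
    by (induction k) (use f(2) n(2) in \<open>auto simp: N_def\<close>)
  have "r k \<le> r 0 * (1 / 100) ^ k" for k
  proof (induction k)
    case (Suc k)
    thus ?case using rS[of k] by simp
  qed simp
  moreover have "(\<lambda>k. r 0 * (1 / 100) ^ k) \<longlonglongrightarrow> r 0 * 0"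
    by (intro tendsto_intros LIMSEQ_power_zero) auto
  ultimately have r_lim: "r \<longlonglongrightarrow> 0"
    using r by (intro tendsto_sandwich[of "\<lambda>_. 0" r _ "\<lambda>k. r 0 * (1 / 100) ^ k"])
      (auto intro!: always_eventually less_imp_le)
  \<comment> \<open>the dilation lemma along the sequence \<open>r\<close>\<close>
  have ev: "\<forall>\<^sub>F k in sequentially. scl \<gamma>' (K * r k) \<le> c * scl \<gamma> (L * r k)"
    if "0 < \<gamma>" "\<gamma> < \<gamma>'" "0 < K" "0 < L" "0 < c" for \<gamma> \<gamma>' K L c
    by (rule eventually_compose_filterlim[OF scaling_dilate[OF scl that]])
      (use r r_lim in \<open>auto simp: filterlim_at intro!: always_eventually less_imp_neq[symmetric]\<close>)
  show ?thesis
  proof (rule that[of r n])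
    fix \<gamma> assume \<gamma>: "0 < \<gamma>" "\<gamma> < \<alpha>"
    have "\<forall>\<^sub>F k in sequentially. scl \<alpha> (r k) \<le> scl \<gamma> (r k / 4)"
      using ev[OF \<gamma>, of 1 "1 / 4" 1] by simp
    moreover have "\<forall>\<^sub>F k in sequentially. scl \<beta> (100 * r k) \<le> scl \<gamma> (r k / 4)"
      using ev[of \<gamma> \<beta> 100 "1 / 4" 1] \<gamma> \<open>\<alpha> \<le> \<beta>\<close> by simp
    ultimately have "\<forall>\<^sub>F k in sequentially. 1 / N k \<le> scl \<gamma> (r k / 4)"
      using eventually_gt_at_top[of 0]
    proof eventually_elim
      case (elim k)
      then obtain j where k: "k = Suc j" by (cases k) auto
      show ?case using A2[of j]
      proof
        assume "r (Suc j) = r j / 100"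
        hence "r j = 100 * r k" by (simp add: k)
        thus ?thesis using A3[of j] elim by (simp add: k)
      qed (use elim in \<open>simp add: k\<close>)
    qed
    thus "\<forall>\<^sub>F k in sequentially. 1 / (\<Prod>i<k. real (n i)) \<le> scl \<gamma> (r k / 4)"
      by (simp add: N_prod)
  next
    fix \<gamma> assume \<gamma>: "\<alpha> < \<gamma>"
    have "\<forall>\<^sub>F k in sequentially. scl \<gamma> (3 * r k) \<le> scl \<alpha> (r k)"
      using ev[OF \<open>0 < \<alpha>\<close> \<gamma>, of 3 1 1] by simp
    hence "\<forall>\<^sub>F k in sequentially. scl \<gamma> (3 * r k) \<le> 1 / N k"
      by eventually_elim (use A1 in \<open>auto intro: order_trans\<close>)
    thus "\<forall>\<^sub>F k in sequentially. scl \<gamma> (3 * r k) \<le> 1 / (\<Prod>i<k. real (n i))"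
      by (simp add: N_prod)
  next
    fix \<gamma> assume \<gamma>: "\<beta> < \<gamma>"
    have "\<forall>\<^sub>F k in sequentially. scl \<gamma> (3 * r k) \<le> scl \<beta> (r k) / 2"
      using ev[OF \<open>0 < \<beta>\<close> \<gamma>, of 3 1 "1 / 2"] by simp
    moreover have "\<forall>\<^sub>F k in sequentially. scl \<gamma> (3 * r k) \<le> scl \<alpha> (r k)"
      using ev[OF \<open>0 < \<alpha>\<close>, of \<gamma> 3 1 1] \<gamma> \<open>\<alpha> \<le> \<beta>\<close> by simp
    ultimately have "\<forall>\<^sub>F k in sequentially. scl \<gamma> (3 * r k) \<le> 1 / N (Suc k)"
    proof eventually_elim
      case (elim k)
      thus ?case using A1[of k] A4[of k] by (simp add: min_def split: if_splits)
    qed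
    thus "\<forall>\<^sub>F k in sequentially. scl \<gamma> (3 * r k) \<le> 1 / (\<Prod>i<Suc k. real (n i))"
      by (simp only: N_prod)
  next
    fix \<gamma> assume \<gamma>: "0 < \<gamma>" "\<gamma> < \<beta>"
    have "\<forall>\<^sub>F k in sequentially. scl \<beta> (r k) \<le> scl \<gamma> (r k / 4)"
      using ev[OF \<gamma>, of 1 "1 / 4" 1] by simp
    hence "\<forall>\<^sub>F k in sequentially. 1 / N (Suc k) \<le> scl \<gamma> (r k / 4)"
      by eventually_elim (use A3 in \<open>auto intro: order_trans\<close>)
    thus "\<forall>\<^sub>F k in sequentially. 1 / (\<Prod>i<Suc k. real (n i)) \<le> scl \<gamma> (r k / 4)"
      by (simp only: N_prod)
  qed (use r rS n in auto)
qed


section \<open>Thresholds, separated sets and packing measures\<close>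

lemma Sup_ennreal_threshold:
  assumes "0 < a" "\<And>g. 0 < g \<Longrightarrow> g < a \<Longrightarrow> P g" "\<And>g. a < g \<Longrightarrow> \<not> P g"
  shows "Sup {ennreal g | g. g > 0 \<and> P g} = ennreal a" (is "Sup ?S = _")
proof (rule antisym)
  have "g \<le> a" if "P g" for g using assms(3)[of g] that by force
  thus "Sup ?S \<le> ennreal a" by (intro Sup_least) (auto intro!: ennreal_leI)
  show "ennreal a \<le> Sup ?S"
  proof (rule dense_le)
    fix b assume b: "b < ennreal a"
    then obtain u where u: "b < u" "u < ennreal a" using dense by blast
    then obtain g where g: "u = ennreal g" "0 \<le> g"
      by (cases u) auto
    have "0 < g" using u g by (cases "g = 0") auto
    moreover have "g < a" using u g by (simp add: ennreal_less_iff)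
    ultimately have "ennreal g \<le> Sup ?S" using assms(2) by (intro Sup_upper) blast
    thus "b \<le> Sup ?S" using u g by simp
  qed
qed

lemma Inf_ennreal_threshold:
  assumes "0 < a" "\<And>g. 0 < g \<Longrightarrow> g < a \<Longrightarrow> \<not> P g" "\<And>g. a < g \<Longrightarrow> P g"
  shows "Inf {ennreal g | g. g > 0 \<and> P g} = ennreal a" (is "Inf ?S = _")
proof (rule antisym)
  have "a \<le> g" if "0 < g" "P g" for g using assms(2)[of g] that by force
  thus "ennreal a \<le> Inf ?S" by (intro Inf_greatest) (auto intro!: ennreal_leI)
  show "Inf ?S \<le> ennreal a"
  proof (rule ennreal_le_epsilon)
    fix e :: real assume "e > 0"
    hence "Inf ?S \<le> ennreal (a + e)"
      using assms by (intro Inf_lower) (auto intro!: exI[of _ "a + e"])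
    thus "Inf ?S \<le> ennreal a + ennreal e" using \<open>e > 0\<close> \<open>a > 0\<close> by simp
  qed
qed

text \<open>
  Total boundedness of \<open>X\<close> bounds the cardinality of \<open>d\<close>-separated subsets, so one of maximal
  cardinality exists; its \<open>d\<close>-balls cover \<open>E\<close>.
\<close>

lemma maximal_separated_set:
  fixes X E :: "'a::metric_space set"
  assumes "compact X" "E \<subseteq> X" "0 < d"
  obtains S where "finite S" "S \<subseteq> E" "pairwise (\<lambda>x y. d \<le> dist x y) S" "E \<subseteq> (\<Union>x\<in>S. ball x d)"
proof -
  obtain K where K: "finite K" "X \<subseteq> (\<Union>x\<in>K. ball x (d / 2))"
    using assms unfolding compact_eq_totally_bounded by (meson half_gt_zero)
  define Q where "Q = (\<lambda>S. finite S \<and> S \<subseteq> E \<and> pairwise (\<lambda>x y. d \<le> dist x y) S)"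
  have bound: "card S \<le> card K" if "Q S" for S
  proof -
    have "\<forall>x\<in>S. \<exists>y\<in>K. dist y x < d / 2" using that assms K unfolding Q_def by fastforce
    then obtain f where f: "\<And>x. x \<in> S \<Longrightarrow> f x \<in> K \<and> dist (f x) x < d / 2" by metis
    have "inj_on f S"
    proof (rule inj_onI, rule ccontr)
      fix x y assume xy: "x \<in> S" "y \<in> S" "f x = f y" "x \<noteq> y"
      hence "d \<le> dist x y" using that unfolding Q_def pairwise_def by blast
      also have "\<dots> < d" using f[of x] f[of y] xy dist_triangle_half_r[of "f x" x d y] by simp
      finally show False by simp
    qed
    thus ?thesis using f K by (intro card_inj_on_le[of f]) auto
  qed
  have "Q {}" by (simp add: Q_def)
  hence "\<exists>S. Q S \<and> (\<forall>T. Q T \<longrightarrow> card T \<le> card S)"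
    using bound by (intro ex_has_greatest_nat[where b = "Suc (card K)"]) (auto simp: less_Suc_eq_le)
  then obtain S where S: "Q S" "\<And>T. Q T \<Longrightarrow> card T \<le> card S" by blast
  have "E \<subseteq> (\<Union>x\<in>S. ball x d)"
  proof
    fix y assume y: "y \<in> E"
    show "y \<in> (\<Union>x\<in>S. ball x d)"
    proof (rule ccontr)
      assume n: "y \<notin> (\<Union>x\<in>S. ball x d)"
      hence "Q (insert y S)" using S y unfolding Q_def
        by (auto simp: pairwise_insert dist_commute not_less)
      hence "card (insert y S) \<le> card S" by (rule S(2))
      moreover have "y \<notin> S" using n assms(3) by auto
      ultimately show False using S by (simp add: Q_def)
    qed
  qed
  thus ?thesis using S(1) that by (auto simp: Q_def)
qed

lemma disjoint_balls_separated:
  assumes "pairwise (\<lambda>x y. 2 * d \<le> dist x y) S"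
  shows "disjoint_family_on (\<lambda>x. ball x d \<inter> X) S"
  unfolding disjoint_family_on_def
proof (intro ballI impI)
  fix x y assume "x \<in> S" "y \<in> S" "x \<noteq> y"
  hence "2 * d \<le> dist x y" using assms by (auto simp: pairwise_def)
  moreover have "dist x y < 2 * d" if "dist x z < d" "dist y z < d" for z
    using dist_triangle2[of x y z] that by simp
  ultimately show "(ball x d \<inter> X) \<inter> (ball y d \<inter> X) = {}" by fastforce
qed

lemma packing_measure_le_pre0: "packing_measure \<phi> X \<le> packing_pre0 \<phi> X"
proof -
  define E where "E = (\<lambda>n::nat. if n = 0 then X else {})"
  have "packing_pre \<phi> 1 ({} :: 'a set) = 0"
    unfolding packing_pre_def eps_pack_def by (auto simp: bot_ennreal[symmetric] intro!: Sup_eqI)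
  hence "packing_pre0 \<phi> ({} :: 'a set) \<le> 0"
    unfolding packing_pre0_eq_INF by (metis INF_lower greaterThan_iff zero_less_one)
  hence "(\<Sum>n. packing_pre0 \<phi> (E n)) = (\<Sum>n\<in>{0}. packing_pre0 \<phi> (E n))"
    by (intro suminf_finite) (auto simp: E_def)
  also have "\<dots> = packing_pre0 \<phi> X" by (simp add: E_def)
  finally show ?thesis
    unfolding packing_measure_def by (intro Inf_lower) (auto simp: E_def intro!: exI[of _ E] split: if_splits)
qed


section \<open>Scales of a measure with uniform local behaviour\<close>

text \<open>
  A compact set \<open>X\<close> with a Borel probability measure \<open>\<nu>\<close> on it, whose lower and upper local scales
  are \<open>\<alpha>\<close> and \<open>\<beta>\<close> uniformly in the centre of the ball: the bounds that hold for all small radii,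
  and those that hold for arbitrarily small radii, hold at each such radius for all centres at once.
\<close>

locale uniform_local_scales =
  fixes scl :: "real \<Rightarrow> real \<Rightarrow> real" and \<alpha> \<beta> :: real
    and X :: "'a::metric_space set" and \<nu> :: "'a measure"
  assumes scl: "scaling scl" and \<alpha>_pos: "0 < \<alpha>" and \<alpha>_le_\<beta>: "\<alpha> \<le> \<beta>"
    and compact_X: "compact X"
    and sets_\<nu>: "sets \<nu> = sets (restrict_space borel X)" and prob_\<nu>: "prob_space \<nu>"
    and eventually_mass_le: "\<And>\<gamma>. 0 < \<gamma> \<Longrightarrow> \<gamma> < \<alpha> \<Longrightarrow>
      \<forall>\<^sub>F \<epsilon> in at_right 0. \<forall>x\<in>X. emeasure \<nu> (ball x \<epsilon> \<inter> X) \<le> ennreal (scl \<gamma> \<epsilon>)"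
    and frequently_mass_ge: "\<And>\<gamma>. \<alpha> < \<gamma> \<Longrightarrow>
      \<exists>\<^sub>F \<epsilon> in at_right 0. \<forall>x\<in>X. ennreal (scl \<gamma> \<epsilon>) \<le> emeasure \<nu> (ball x \<epsilon> \<inter> X)"
    and eventually_mass_ge: "\<And>\<gamma>. \<beta> < \<gamma> \<Longrightarrow>
      \<forall>\<^sub>F \<epsilon> in at_right 0. \<forall>x\<in>X. ennreal (scl \<gamma> \<epsilon>) \<le> emeasure \<nu> (ball x \<epsilon> \<inter> X)"
    and frequently_mass_le: "\<And>\<gamma>. 0 < \<gamma> \<Longrightarrow> \<gamma> < \<beta> \<Longrightarrow>
      \<exists>\<^sub>F \<epsilon> in at_right 0. \<forall>x\<in>X. emeasure \<nu> (ball x \<epsilon> \<inter> X) \<le> ennreal (scl \<gamma> \<epsilon>)"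
begin

interpretation \<nu>: prob_space \<nu> by (rule prob_\<nu>)

lemma space_\<nu>: "space \<nu> = X"
  using sets_eq_imp_space_eq[OF sets_\<nu>] by (simp add: space_restrict_space)

lemma ball_in_sets [measurable, simp]: "ball x r \<inter> X \<in> sets \<nu>"
  unfolding sets_\<nu> sets_restrict_space by (auto simp: Int_commute)

lemma \<beta>_pos: "0 < \<beta>" using \<alpha>_pos \<alpha>_le_\<beta> by simp

lemma emeasure_X: "emeasure \<nu> X = 1"
  using \<nu>.emeasure_space_1 by (simp add: space_\<nu>)

lemma scl_pos: "0 < \<gamma> \<Longrightarrow> 0 < r \<Longrightarrow> 0 < scl \<gamma> r"
  using hausdorff_functionD(4)[OF scaling_hausdorff_function[OF scl]] .

text \<open>
  The mass is at most \<open>scl \<gamma>' \<epsilon>\<close> for an index \<open>\<gamma>'\<close> strictly between \<open>\<gamma>\<close> and \<open>\<alpha>\<close>, and hence at most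
  \<open>c * scl \<gamma> \<epsilon>\<close> for any constant \<open>c > 0\<close>. The same device is used below for \<open>\<beta>\<close> and for the measures.
\<close>

lemma upper_density_eq_0:
  assumes "0 < \<gamma>" "\<gamma> < \<alpha>" "x \<in> X"
  shows "upper_density \<nu> (scl \<gamma>) x = 0"
proof -
  obtain \<gamma>' where \<gamma>': "\<gamma> < \<gamma>'" "\<gamma>' < \<alpha>" using assms dense by blast
  have *: "upper_density \<nu> (scl \<gamma>) x \<le> 0 + ennreal c" if "c > 0" for c
  proof -
    have "\<forall>\<^sub>F \<epsilon> in at_right 0. \<forall>x\<in>X. emeasure \<nu> (ball x \<epsilon> \<inter> X) \<le> ennreal (scl \<gamma>' \<epsilon>)"
      using eventually_mass_le assms \<gamma>' by simp
    moreover have "\<forall>\<^sub>F \<epsilon> in at_right 0. scl \<gamma>' (1 * \<epsilon>) \<le> c * scl \<gamma> (1 * \<epsilon>)"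
      using scl assms \<gamma>' that by (intro scaling_dilate) auto
    ultimately have "\<forall>\<^sub>F \<epsilon> in at_right 0.
        emeasure \<nu> (ball x \<epsilon> \<inter> space \<nu>) / ennreal (scl \<gamma> \<epsilon>) \<le> ennreal c"
      using eventually_at_right_less[of 0]
    proof eventually_elim
      case (elim \<epsilon>)
      have "emeasure \<nu> (ball x \<epsilon> \<inter> space \<nu>) \<le> ennreal (c * scl \<gamma> \<epsilon>)"
        using elim assms(3) ennreal_leI[of "scl \<gamma>' \<epsilon>" "c * scl \<gamma> \<epsilon>"] unfolding space_\<nu>
        by (auto intro: order_trans)
      hence "emeasure \<nu> (ball x \<epsilon> \<inter> space \<nu>) / ennreal (scl \<gamma> \<epsilon>)
          \<le> ennreal (c * scl \<gamma> \<epsilon>) / ennreal (scl \<gamma> \<epsilon>)" by (rule divide_right_mono_ennreal)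
      thus ?case using scl_pos[of \<gamma> \<epsilon>] elim assms that by (simp add: divide_ennreal)
    qed
    thus ?thesis unfolding upper_density_def by (simp add: Limsup_bounded)
  qed
  have "upper_density \<nu> (scl \<gamma>) x \<le> 0" by (rule ennreal_le_epsilon) (rule *)
  thus ?thesis by simp
qed

lemma upper_density_neq_0:
  assumes "\<alpha> < \<gamma>" "x \<in> X"
  shows "upper_density \<nu> (scl \<gamma>) x \<noteq> 0"
proof
  assume "upper_density \<nu> (scl \<gamma>) x = 0"
  hence "\<forall>\<^sub>F \<epsilon> in at_right 0. emeasure \<nu> (ball x \<epsilon> \<inter> space \<nu>) / ennreal (scl \<gamma> \<epsilon>) < 1"
    unfolding upper_density_def by (intro Limsup_lessD) simp
  hence "\<forall>\<^sub>F \<epsilon> in at_right 0. \<not> (\<forall>x\<in>X. ennreal (scl \<gamma> \<epsilon>) \<le> emeasure \<nu> (ball x \<epsilon> \<inter> X))"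
    using eventually_at_right_less[of 0]
  proof eventually_elim
    case (elim \<epsilon>)
    show ?case
    proof
      assume "\<forall>x\<in>X. ennreal (scl \<gamma> \<epsilon>) \<le> emeasure \<nu> (ball x \<epsilon> \<inter> X)"
      hence "ennreal (scl \<gamma> \<epsilon>) / ennreal (scl \<gamma> \<epsilon>)
          \<le> emeasure \<nu> (ball x \<epsilon> \<inter> space \<nu>) / ennreal (scl \<gamma> \<epsilon>)"
        using assms by (intro divide_right_mono_ennreal) (simp add: space_\<nu>)
      thus False using elim scl_pos[of \<gamma> \<epsilon>] assms \<alpha>_pos by (simp add: divide_ennreal)
    qed
  qed
  thus False using frequently_mass_ge[OF assms(1)] by (simp add: frequently_def)
qed

lemma lower_density_eq_top:
  assumes "\<beta> < \<gamma>" "x \<in> X"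
  shows "lower_density \<nu> (scl \<gamma>) x = \<infinity>"
proof -
  obtain \<gamma>' where \<gamma>': "\<beta> < \<gamma>'" "\<gamma>' < \<gamma>" using assms dense by blast
  have "ennreal K \<le> lower_density \<nu> (scl \<gamma>) x" if "K > 0" for K
  proof -
    have "\<forall>\<^sub>F \<epsilon> in at_right 0. \<forall>x\<in>X. ennreal (scl \<gamma>' \<epsilon>) \<le> emeasure \<nu> (ball x \<epsilon> \<inter> X)"
      using eventually_mass_ge \<gamma>' by simp
    moreover have "\<forall>\<^sub>F \<epsilon> in at_right 0. scl \<gamma> (1 * \<epsilon>) \<le> (1 / K) * scl \<gamma>' (1 * \<epsilon>)"
      using scl assms \<gamma>' that \<beta>_pos by (intro scaling_dilate) auto
    ultimately have "\<forall>\<^sub>F \<epsilon> in at_right 0.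
        ennreal K \<le> emeasure \<nu> (ball x \<epsilon> \<inter> space \<nu>) / ennreal (scl \<gamma> \<epsilon>)"
      using eventually_at_right_less[of 0]
    proof eventually_elim
      case (elim \<epsilon>)
      have "ennreal (K * scl \<gamma> \<epsilon>) \<le> emeasure \<nu> (ball x \<epsilon> \<inter> space \<nu>)"
        using elim assms that order_trans[OF ennreal_leI]
        by (simp add: space_\<nu> field_simps)
      hence "ennreal (K * scl \<gamma> \<epsilon>) / ennreal (scl \<gamma> \<epsilon>)
          \<le> emeasure \<nu> (ball x \<epsilon> \<inter> space \<nu>) / ennreal (scl \<gamma> \<epsilon>)"
        by (rule divide_right_mono_ennreal)
      thus ?case using scl_pos[of \<gamma> \<epsilon>] elim assms that \<beta>_pos by (simp add: divide_ennreal)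
    qed
    thus ?thesis unfolding lower_density_def by (intro Liminf_bounded) simp
  qed
  note K = this
  show ?thesis
  proof (cases "lower_density \<nu> (scl \<gamma>) x")
    case (real t)
    thus ?thesis using K[of "t + 1"] by simp
  qed simp
qed

lemma lower_density_neq_top:
  assumes "0 < \<gamma>" "\<gamma> < \<beta>" "x \<in> X"
  shows "lower_density \<nu> (scl \<gamma>) x \<noteq> \<infinity>"
proof
  assume "lower_density \<nu> (scl \<gamma>) x = \<infinity>"
  hence "\<forall>\<^sub>F \<epsilon> in at_right 0. 1 < emeasure \<nu> (ball x \<epsilon> \<inter> space \<nu>) / ennreal (scl \<gamma> \<epsilon>)"
    unfolding lower_density_def by (intro less_LiminfD) simp
  hence "\<forall>\<^sub>F \<epsilon> in at_right 0. \<not> (\<forall>x\<in>X. emeasure \<nu> (ball x \<epsilon> \<inter> X) \<le> ennreal (scl \<gamma> \<epsilon>))"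
    using eventually_at_right_less[of 0]
  proof eventually_elim
    case (elim \<epsilon>)
    show ?case
    proof
      assume "\<forall>x\<in>X. emeasure \<nu> (ball x \<epsilon> \<inter> X) \<le> ennreal (scl \<gamma> \<epsilon>)"
      hence "emeasure \<nu> (ball x \<epsilon> \<inter> space \<nu>) / ennreal (scl \<gamma> \<epsilon>)
          \<le> ennreal (scl \<gamma> \<epsilon>) / ennreal (scl \<gamma> \<epsilon>)"
        using assms by (intro divide_right_mono_ennreal) (simp add: space_\<nu>)
      thus False using elim scl_pos[of \<gamma> \<epsilon>] assms by (simp add: divide_ennreal)
    qed
  qed
  thus False using frequently_mass_le[OF assms(1,2)] by (simp add: frequently_def)
qed

lemma lower_local_scale_eq: "x \<in> X \<Longrightarrow> lower_local_scale scl \<nu> x = ennreal \<alpha>"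
  unfolding lower_local_scale_def
  by (rule Sup_ennreal_threshold) (auto simp: \<alpha>_pos upper_density_eq_0 upper_density_neq_0)

lemma upper_local_scale_eq: "x \<in> X \<Longrightarrow> upper_local_scale scl \<nu> x = ennreal \<beta>"
  unfolding upper_local_scale_def
  by (rule Inf_ennreal_threshold) (simp_all add: \<beta>_pos lower_density_eq_top lower_density_neq_top[simplified])

text \<open>
  The mass distribution principle: each cover by small balls has sum at least \<open>\<nu>(X) = 1\<close>.
  Compactness reduces a countable cover by open balls to a finite one.
\<close>

lemma hausdorff_measure_neq_0:
  assumes "0 < \<gamma>" "\<gamma> < \<alpha>"
  shows "hausdorff_measure (scl \<gamma>) X \<noteq> 0"
proof -
  obtain d where d: "d > 0"
    "\<And>\<epsilon> x. 0 < \<epsilon> \<Longrightarrow> \<epsilon> < d \<Longrightarrow> x \<in> X \<Longrightarrow> emeasure \<nu> (ball x \<epsilon> \<inter> X) \<le> ennreal (scl \<gamma> \<epsilon>)"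
    using eventually_mass_le[OF assms] unfolding eventually_at_right_field by blast
  have "1 \<le> hausdorff_pre (scl \<gamma>) (d / 2) X"
    unfolding hausdorff_pre_def
  proof (rule Inf_greatest, clarify)
    fix C assume C: "eps_cover (d / 2) X C"
    have "X \<subseteq> (\<Union>p\<in>C. ball (fst p) (snd p))"
    proof
      fix y assume "y \<in> X"
      then obtain p where "p \<in> C" "y \<in> (case p of (x, r) \<Rightarrow> ball x r \<inter> X)"
        using C unfolding eps_cover_def by blast
      thus "y \<in> (\<Union>p\<in>C. ball (fst p) (snd p))" by (cases p) force
    qed
    then obtain D where D: "D \<subseteq> C" "finite D" "X \<subseteq> (\<Union>p\<in>D. ball (fst p) (snd p))"
      using compactE_image[OF compact_X, of C "\<lambda>p. ball (fst p) (snd p)"] by auto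
    have "1 = emeasure \<nu> (\<Union>p\<in>D. ball (fst p) (snd p) \<inter> X)"
      unfolding emeasure_X[symmetric] using D by (intro arg_cong[where f = "emeasure \<nu>"]) auto
    also have "\<dots> \<le> (\<Sum>p\<in>D. emeasure \<nu> (ball (fst p) (snd p) \<inter> X))"
      using D by (intro emeasure_subadditive_finite) auto
    also have "\<dots> \<le> (\<Sum>p\<in>D. case p of (x, r) \<Rightarrow> ennreal (scl \<gamma> r))"
    proof (rule sum_mono, clarify)
      fix x r assume "(x, r) \<in> D"
      hence "x \<in> X" "0 < r" "r < d" using D C d(1) unfolding eps_cover_def by force+
      thus "emeasure \<nu> (ball (fst (x, r)) (snd (x, r)) \<inter> X) \<le> ennreal (scl \<gamma> r)" using d by simp
    qed
    also have "\<dots> \<le> (\<Sum>\<^sub>\<infinity>(x, r)\<in>C. ennreal (scl \<gamma> r))"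
      using D by (subst nonneg_infsum_complete) (auto intro!: SUP_upper)
    finally show "1 \<le> (\<Sum>\<^sub>\<infinity>(x, r)\<in>C. ennreal (scl \<gamma> r))" .
  qed
  also have "\<dots> \<le> hausdorff_measure (scl \<gamma>) X"
    unfolding hausdorff_measure_eq_SUP using d by (intro SUP_upper) simp
  finally show ?thesis by auto
qed

text \<open>
  At a radius \<open>s\<close> where balls have mass at least \<open>scl \<gamma>' s\<close>, the balls of radius \<open>2 s\<close> around a
  maximal \<open>2 s\<close>-separated set form a cover, while those of radius \<open>s\<close> are disjoint.
\<close>

lemma hausdorff_measure_neq_top:
  assumes "\<alpha> < \<gamma>"
  shows "hausdorff_measure (scl \<gamma>) X \<noteq> \<infinity>"
proof -
  obtain \<gamma>' where \<gamma>': "\<alpha> < \<gamma>'" "\<gamma>' < \<gamma>" using assms dense by blast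
  have "hausdorff_pre (scl \<gamma>) \<epsilon> X \<le> 1" if "\<epsilon> > 0" for \<epsilon>
  proof -
    have "\<forall>\<^sub>F s in at_right 0. scl \<gamma> (2 * s) \<le> 1 * scl \<gamma>' (1 * s)"
      using scl \<gamma>' \<alpha>_pos by (intro scaling_dilate) auto
    moreover have "\<forall>\<^sub>F s in at_right 0. s \<in> {0<..<\<epsilon> / 2}"
      using that by (intro eventually_at_right_real) simp
    ultimately have "\<forall>\<^sub>F s in at_right 0. scl \<gamma> (2 * s) \<le> scl \<gamma>' s \<and> s \<in> {0<..<\<epsilon> / 2}"
      by eventually_elim simp
    from frequently_ex[OF frequently_eventually_frequently[OF frequently_mass_ge[OF \<gamma>'(1)] this]]
    obtain s where s: "\<And>x. x \<in> X \<Longrightarrow> ennreal (scl \<gamma>' s) \<le> emeasure \<nu> (ball x s \<inter> X)"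
      "scl \<gamma> (2 * s) \<le> scl \<gamma>' s" "0 < s" "2 * s < \<epsilon>" by (auto simp: mult.commute)
    obtain S where S: "finite S" "S \<subseteq> X" "pairwise (\<lambda>x y. 2 * s \<le> dist x y) S"
      "X \<subseteq> (\<Union>x\<in>S. ball x (2 * s))"
      using maximal_separated_set[OF compact_X order_refl, of "2 * s"] s by auto
    define C where "C = (\<lambda>x. (x, 2 * s)) ` S"
    have C: "eps_cover \<epsilon> X C"
      using S s unfolding eps_cover_def C_def by (auto simp: countable_finite)
    have "(\<Sum>\<^sub>\<infinity>(x, r)\<in>C. ennreal (scl \<gamma> r)) = (\<Sum>x\<in>S. ennreal (scl \<gamma> (2 * s)))"
      using S unfolding C_def by (subst infsum_finite) (auto simp: sum.reindex inj_on_def)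
    also have "\<dots> \<le> (\<Sum>x\<in>S. emeasure \<nu> (ball x s \<inter> X))"
      using s S by (intro sum_mono) (auto intro: order_trans[OF ennreal_leI])
    also have "\<dots> = emeasure \<nu> (\<Union>x\<in>S. ball x s \<inter> X)"
      using S by (intro sum_emeasure disjoint_balls_separated) auto
    also have "\<dots> \<le> 1" by (rule \<nu>.emeasure_le_1)
    finally show ?thesis
      unfolding hausdorff_pre_def using C by (intro Inf_lower2) auto
  qed
  hence "hausdorff_measure (scl \<gamma>) X \<le> 1"
    unfolding hausdorff_measure_eq_SUP by (intro SUP_least) auto
  thus ?thesis by (auto simp: top_unique)
qed

lemma hausdorff_scale_eq: "hausdorff_scale scl X = ennreal \<alpha>"
proof (rule antisym)
  have "\<gamma> \<le> \<alpha>" if "hausdorff_measure (scl \<gamma>) X = \<infinity>" for \<gamma>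
    using hausdorff_measure_neq_top[of \<gamma>] that by force
  thus "hausdorff_scale scl X \<le> ennreal \<alpha>"
    unfolding hausdorff_scale_def by (intro Sup_least) (auto intro!: ennreal_leI)
  have "\<alpha> \<le> \<gamma>" if "\<gamma> > 0" "hausdorff_measure (scl \<gamma>) X = 0" for \<gamma>
    using hausdorff_measure_neq_0[of \<gamma>] that by force
  thus "ennreal \<alpha> \<le> hausdorff_scale scl X"
    unfolding hausdorff_scale_eq_Inf[OF scl] by (intro Inf_greatest) (auto intro!: ennreal_leI)
qed

text \<open>The disjoint balls of a pack have total mass at most \<open>1\<close>.\<close>

lemma packing_measure_neq_top:
  assumes "\<beta> < \<gamma>"
  shows "packing_measure (scl \<gamma>) X \<noteq> \<infinity>"
proof -
  obtain d where d: "d > 0"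
    "\<And>\<epsilon> x. 0 < \<epsilon> \<Longrightarrow> \<epsilon> < d \<Longrightarrow> x \<in> X \<Longrightarrow> ennreal (scl \<gamma> \<epsilon>) \<le> emeasure \<nu> (ball x \<epsilon> \<inter> X)"
    using eventually_mass_ge[OF assms] unfolding eventually_at_right_field by blast
  have "packing_pre (scl \<gamma>) (d / 2) X \<le> 1"
    unfolding packing_pre_def
  proof (rule Sup_least, clarify)
    fix C assume C: "eps_pack (d / 2) X C"
    have "(\<Sum>p\<in>F. case p of (x, r) \<Rightarrow> ennreal (scl \<gamma> r)) \<le> 1" if F: "finite F" "F \<subseteq> C" for F
    proof -
      have "(\<Sum>p\<in>F. case p of (x, r) \<Rightarrow> ennreal (scl \<gamma> r))
          \<le> (\<Sum>p\<in>F. emeasure \<nu> (case p of (x, r) \<Rightarrow> ball x r \<inter> X))"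
      proof (rule sum_mono, clarify)
        fix x r assume "(x, r) \<in> F"
        hence "x \<in> X" "0 < r" "r < d" using F C d(1) unfolding eps_pack_def by force+
        thus "ennreal (scl \<gamma> r) \<le> emeasure \<nu> (ball x r \<inter> X)" using d by simp
      qed
      also have "\<dots> = emeasure \<nu> (\<Union>p\<in>F. case p of (x, r) \<Rightarrow> ball x r \<inter> X)"
        using F C unfolding eps_pack_def
        by (intro sum_emeasure) (auto intro: disjoint_family_on_mono)
      also have "\<dots> \<le> 1" by (rule \<nu>.emeasure_le_1)
      finally show ?thesis .
    qed
    thus "(\<Sum>\<^sub>\<infinity>(x, r)\<in>C. ennreal (scl \<gamma> r)) \<le> 1"
      by (subst nonneg_infsum_complete) (auto intro!: SUP_least)
  qed
  moreover have "packing_pre0 (scl \<gamma>) X \<le> packing_pre (scl \<gamma>) (d / 2) X"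
    unfolding packing_pre0_eq_INF using d by (intro INF_lower) simp
  ultimately have "packing_measure (scl \<gamma>) X \<le> 1"
    using packing_measure_le_pre0[of "scl \<gamma>" X] by simp
  thus ?thesis by (auto simp: top_unique)
qed

text \<open>
  At a radius \<open>s\<close> where balls have mass at most \<open>scl \<gamma>' s \<le> scl \<gamma> (s / 2)\<close>, the balls of radius
  \<open>s\<close> around a maximal \<open>s\<close>-separated subset of \<open>E\<close> cover \<open>E\<close>, while those of radius \<open>s / 2\<close>
  form a pack of \<open>E\<close>. Outer measure is needed because the sets in the definition of the packing
  measure are arbitrary.
\<close>

lemma outer_measure_le_packing_pre0:
  assumes "0 < \<gamma>" "\<gamma> < \<beta>" "E \<subseteq> X"
  shows "outer_measure_of \<nu> E \<le> packing_pre0 (scl \<gamma>) E"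
  unfolding packing_pre0_eq_INF
proof (rule INF_greatest)
  fix \<epsilon> :: real assume "\<epsilon> \<in> {0<..}"
  hence "\<epsilon> > 0" by simp
  obtain \<gamma>' where \<gamma>': "\<gamma> < \<gamma>'" "\<gamma>' < \<beta>" using assms dense by blast
  have "\<forall>\<^sub>F s in at_right 0. scl \<gamma>' (1 * s) \<le> 1 * scl \<gamma> (1 / 2 * s)"
    using scl \<gamma>' assms by (intro scaling_dilate) auto
  moreover have "\<forall>\<^sub>F s in at_right 0. s \<in> {0<..<\<epsilon>}"
    using \<open>\<epsilon> > 0\<close> by (rule eventually_at_right_real)
  ultimately have "\<forall>\<^sub>F s in at_right 0. scl \<gamma>' s \<le> scl \<gamma> (s / 2) \<and> s \<in> {0<..<\<epsilon>}"
    by eventually_elim simp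
  from frequently_ex[OF frequently_eventually_frequently[OF frequently_mass_le[OF _ \<gamma>'(2)] this]]
  obtain s where s: "\<And>x. x \<in> X \<Longrightarrow> emeasure \<nu> (ball x s \<inter> X) \<le> ennreal (scl \<gamma>' s)"
    "scl \<gamma>' s \<le> scl \<gamma> (s / 2)" "0 < s" "s < \<epsilon>" using \<gamma>' assms by auto
  obtain S where S: "finite S" "S \<subseteq> E" "pairwise (\<lambda>x y. s \<le> dist x y) S"
    "E \<subseteq> (\<Union>x\<in>S. ball x s)"
    using maximal_separated_set[OF compact_X assms(3) s(3)] by blast
  define C where "C = (\<lambda>x. (x, s / 2)) ` S"
  have "disjoint_family_on (\<lambda>x. ball x (s / 2) \<inter> E) S"
    using S by (intro disjoint_balls_separated) simp
  hence C: "eps_pack \<epsilon> E C"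
    using S s unfolding eps_pack_def C_def
    by (auto simp: countable_finite disjoint_family_on_def)
  have "outer_measure_of \<nu> E \<le> outer_measure_of \<nu> (\<Union>x\<in>S. ball x s \<inter> X)"
    using S assms by (intro outer_measure_of_mono) blast
  also have "\<dots> = emeasure \<nu> (\<Union>x\<in>S. ball x s \<inter> X)"
    using S by (intro outer_measure_of_eq sets.finite_UN) auto
  also have "\<dots> \<le> (\<Sum>x\<in>S. emeasure \<nu> (ball x s \<inter> X))"
    using S by (intro emeasure_subadditive_finite) auto
  also have "\<dots> \<le> (\<Sum>x\<in>S. ennreal (scl \<gamma> (s / 2)))"
    using s S assms by (intro sum_mono order_trans[OF s(1)] ennreal_leI) auto
  also have "\<dots> = (\<Sum>\<^sub>\<infinity>(x, r)\<in>C. ennreal (scl \<gamma> r))"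
    using S unfolding C_def by (subst infsum_finite) (auto simp: sum.reindex inj_on_def)
  also have "\<dots> \<le> packing_pre (scl \<gamma>) \<epsilon> E"
    unfolding packing_pre_def using C by (intro Sup_upper) auto
  finally show "outer_measure_of \<nu> E \<le> packing_pre (scl \<gamma>) \<epsilon> E" .
qed

lemma packing_measure_neq_0:
  assumes "0 < \<gamma>" "\<gamma> < \<beta>"
  shows "packing_measure (scl \<gamma>) X \<noteq> 0"
proof -
  have "1 \<le> packing_measure (scl \<gamma>) X"
    unfolding packing_measure_def
  proof (rule Inf_greatest, clarify)
    fix E :: "nat \<Rightarrow> 'a set" assume E: "X = (\<Union>n. E n)"
    have "\<forall>n. \<exists>A. A \<in> sets \<nu> \<and> E n \<subseteq> A \<and> outer_measure_of \<nu> (E n) = emeasure \<nu> A"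
      using E by (auto intro!: outer_measure_of_attain[simplified Bex_def] simp: space_\<nu>)
    then obtain A where A: "\<And>n. A n \<in> sets \<nu>" "\<And>n. E n \<subseteq> A n"
      "\<And>n. outer_measure_of \<nu> (E n) = emeasure \<nu> (A n)" by metis
    have "1 \<le> emeasure \<nu> (\<Union>n. A n)"
      unfolding emeasure_X[symmetric] using E A by (intro emeasure_mono) auto
    also have "\<dots> \<le> (\<Sum>n. emeasure \<nu> (A n))"
      using A by (intro emeasure_subadditive_countably) auto
    also have "\<dots> \<le> (\<Sum>n. packing_pre0 (scl \<gamma>) (E n))"
      unfolding A(3)[symmetric] using assms E
      by (intro suminf_le outer_measure_le_packing_pre0) auto
    finally show "1 \<le> (\<Sum>n. packing_pre0 (scl \<gamma>) (E n))" .
  qed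
  thus ?thesis by auto
qed

lemma packing_scale_eq: "packing_scale scl X = ennreal \<beta>"
proof (rule antisym)
  have "\<gamma> \<le> \<beta>" if "packing_measure (scl \<gamma>) X = \<infinity>" for \<gamma>
    using packing_measure_neq_top[of \<gamma>] that by force
  thus "packing_scale scl X \<le> ennreal \<beta>"
    unfolding packing_scale_def by (intro Sup_least) (auto intro!: ennreal_leI)
  have "\<beta> \<le> \<gamma>" if "\<gamma> > 0" "packing_measure (scl \<gamma>) X = 0" for \<gamma>
    using packing_measure_neq_0[of \<gamma>] that by force
  thus "ennreal \<beta> \<le> packing_scale scl X"
    unfolding packing_scale_eq_Inf[OF scl] by (intro Inf_greatest) (auto intro!: ennreal_leI)
qed

end


section \<open>The Cantor set of separated digit expansions\<close>

text \<open>
  The data of the Cantor set: unit vectors \<open>e i\<close> pairwise at distance at least \<open>1/2\<close>, lacunary radii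
  \<open>r k\<close>, and the number \<open>n k\<close> of digits available at level \<open>k\<close>.
\<close>

locale separated_cantor =
  fixes e :: "nat \<Rightarrow> 'a::banach" and r :: "nat \<Rightarrow> real" and n :: "nat \<Rightarrow> nat"
  assumes norm_e: "\<And>i. norm (e i) = 1"
    and separated_e: "\<And>i j. i \<noteq> j \<Longrightarrow> 1 / 2 \<le> norm (e i - e j)"
    and r_pos: "\<And>k. 0 < r k" and r_Suc: "\<And>k. r (Suc k) \<le> r k / 100"
    and n_ge_1: "\<And>k. 1 \<le> n k"
begin

text \<open>
  The point with digit sequence \<open>w\<close>. Reduction modulo \<open>n k\<close> makes every sequence of natural numbers
  an admissible one, so that \<open>point\<close> is defined and continuous on the whole product space.
\<close>

definition point :: "(nat \<Rightarrow> nat) \<Rightarrow> 'a" where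
  "point w = (\<Sum>k. r k *\<^sub>R e (w k mod n k))"

text \<open>The Cantor set of all points with digits \<open>w k < n k\<close>.\<close>

definition cantor :: "'a set" where
  "cantor = range point"

text \<open>The law of independent digits, the \<open>k\<close>-th being uniform on \<open>{..<n k}\<close>.\<close>

definition digits :: "(nat \<Rightarrow> nat) measure" where
  "digits = Pi\<^sub>M UNIV (\<lambda>k. measure_pmf (pmf_of_set {..<n k}))"

text \<open>The law of the point with random digits, as a measure on \<open>cantor\<close>.\<close>

definition cantor_measure :: "'a measure" where
  "cantor_measure = distr digits (restrict_space borel cantor) point"

lemma n_pos [simp]: "0 < n k" using n_ge_1[of k] by simp

lemma r_add_le: "r (j + k) \<le> r k * (1 / 100) ^ j"
proof (induction j)
  case (Suc j)
  thus ?case using r_Suc[of "j + k"] by simp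
qed simp

lemma r_antimono: "k \<le> m \<Longrightarrow> r m \<le> r k"
proof (rule lift_Suc_antimono_le[of r])
  fix i show "r (Suc i) \<le> r i" using r_Suc[of i] r_pos[of i] by simp
qed

lemma summable_r: "summable r"
  by (rule summable_comparison_test'[of "\<lambda>k. r 0 * (1 / 100) ^ k" 0])
    (use r_add_le[of _ 0] r_pos in \<open>auto intro!: summable_mult summable_geometric simp: less_imp_le\<close>)

lemma r_tendsto_0: "r \<longlonglongrightarrow> 0"
  using summable_r by (rule summable_LIMSEQ_zero)

text \<open>Every small radius lies between consecutive members of the sequence \<open>c * r k\<close>.\<close>

lemma between_scales:
  assumes "0 < \<epsilon>" "0 < c" "\<epsilon> \<le> c * r K"
  obtains k where "K \<le> k" "c * r (Suc k) < \<epsilon>" "\<epsilon> \<le> c * r k"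
proof -
  have "\<forall>\<^sub>F k in sequentially. r k < \<epsilon> / c"
    using assms by (intro order_tendstoD(2)[OF r_tendsto_0]) simp
  hence ex: "\<exists>k. c * r k < \<epsilon>"
    using assms by (auto simp: eventually_sequentially field_simps)
  define j where "j = (LEAST k. c * r k < \<epsilon>)"
  have j: "c * r j < \<epsilon>" unfolding j_def using ex by (rule LeastI_ex)
  have "K < j"
  proof (rule ccontr)
    assume "\<not> K < j"
    hence "c * r K \<le> c * r j" using r_antimono[of j K] assms by (intro mult_left_mono) auto
    thus False using j assms by linarith
  qed
  then obtain k where k: "j = Suc k" "K \<le> k" by (cases j) auto
  have "\<epsilon> \<le> c * r k" using not_less_Least[of k "\<lambda>k. c * r k < \<epsilon>"] k by (simp add: j_def)
  thus ?thesis using that k j by simp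
qed

lemma summable_point: "summable (\<lambda>k. r k *\<^sub>R e (w k mod n k))"
  by (rule summable_comparison_test'[OF summable_r, of 0]) (simp add: norm_e r_pos less_imp_le)

abbreviation term_diff :: "(nat \<Rightarrow> nat) \<Rightarrow> (nat \<Rightarrow> nat) \<Rightarrow> nat \<Rightarrow> 'a" where
  "term_diff w v k \<equiv> r k *\<^sub>R e (w k mod n k) - r k *\<^sub>R e (v k mod n k)"

lemma summable_term_diff: "summable (term_diff w v)"
  by (intro summable_diff summable_point)

lemma point_diff: "point w - point v = (\<Sum>k. term_diff w v k)"
  unfolding point_def by (intro suminf_diff summable_point)

lemma norm_tail_le: "norm (\<Sum>j. term_diff w v (j + k)) < 3 * r k"
proof -
  have le: "norm (term_diff w v (j + k)) \<le> 2 * r k * (1 / 100) ^ j" for j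
  proof -
    have "norm (term_diff w v (j + k)) \<le> r (j + k) + r (j + k)"
      by (rule order_trans[OF norm_triangle_ineq4]) (simp add: norm_e r_pos less_imp_le)
    thus ?thesis using r_add_le[of j k] by simp
  qed
  have geo: "(\<lambda>j. 2 * r k * (1 / 100) ^ j) sums (2 * r k * (1 / (1 - 1 / 100)))"
    by (intro sums_mult geometric_sums) simp
  have sm: "summable (\<lambda>j. norm (term_diff w v (j + k)))"
    by (rule summable_comparison_test'[OF sums_summable[OF geo], of 0]) (use le in simp)
  have "norm (\<Sum>j. term_diff w v (j + k)) \<le> (\<Sum>j. norm (term_diff w v (j + k)))"
    by (rule summable_norm[OF sm])
  also have "\<dots> \<le> (\<Sum>j. 2 * r k * (1 / 100) ^ j)"
    by (intro suminf_le le sm sums_summable[OF geo])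
  also have "\<dots> = 2 * r k * (1 / (1 - 1 / 100))" using geo by (simp add: sums_iff)
  also have "\<dots> < 3 * r k" using r_pos[of k] by simp
  finally show ?thesis .
qed

lemma dist_point_less:
  assumes "\<And>i. i < k \<Longrightarrow> w i mod n i = v i mod n i"
  shows "dist (point w) (point v) < 3 * r k"
proof -
  have "point w - point v = (\<Sum>j. term_diff w v (j + k)) + (\<Sum>i<k. term_diff w v i)"
    unfolding point_diff by (rule suminf_split_initial_segment[OF summable_term_diff])
  also have "(\<Sum>i<k. term_diff w v i) = 0" using assms by (intro sum.neutral) auto
  finally show ?thesis using norm_tail_le[of k w v] by (simp add: dist_norm)
qed

text \<open>
  At the first level \<open>m\<close> where the digits differ, the term of level \<open>m\<close> contributes at least \<open>r m / 2\<close>,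
  and the tail after it less than \<open>3 * r (Suc m) \<le> 3 * r m / 100\<close>. If \<open>m \<le> k\<close>, then \<open>r k \<le> r m\<close>, so the
  distance would exceed \<open>r k / 4\<close>.
\<close>

lemma digits_eq_of_dist_less:
  assumes "dist (point w) (point v) < r k / 4" "i \<le> k"
  shows "w i mod n i = v i mod n i"
proof (rule ccontr)
  assume ne: "w i mod n i \<noteq> v i mod n i"
  define m where "m = (LEAST i. w i mod n i \<noteq> v i mod n i)"
  have m: "w m mod n m \<noteq> v m mod n m" unfolding m_def using ne by (rule LeastI)
  have "m \<le> k" unfolding m_def using Least_le[of _ i] ne assms(2) by (meson order_trans)
  have "point w - point v = (\<Sum>j. term_diff w v (j + Suc m)) + (\<Sum>i<Suc m. term_diff w v i)"
    unfolding point_diff by (rule suminf_split_initial_segment[OF summable_term_diff])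
  also have "(\<Sum>i<Suc m. term_diff w v i) = term_diff w v m"
  proof -
    have "term_diff w v i = 0" if "i < m" for i
      using not_less_Least[OF that[unfolded m_def]] by simp
    thus ?thesis by (simp add: sum.neutral)
  qed
  finally have "term_diff w v m = (point w - point v) - (\<Sum>j. term_diff w v (j + Suc m))"
    by simp
  hence "norm (term_diff w v m)
      \<le> norm (point w - point v) + norm (\<Sum>j. term_diff w v (j + Suc m))"
    by (simp only: norm_triangle_ineq4)
  also have "\<dots> < r k / 4 + 3 * r (Suc m)"
    using norm_tail_le[of "Suc m" w v] assms(1) by (simp add: dist_norm)
  also have "\<dots> < r m / 2"
    using r_antimono[OF \<open>m \<le> k\<close>] r_Suc[of m] r_pos[of m] by simp
  also have "\<dots> \<le> r m * norm (e (w m mod n m) - e (v m mod n m))"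
    using separated_e[OF m] r_pos[of m] mult_left_mono[of "1/2" _ "r m"] by simp
  also have "\<dots> = norm (term_diff w v m)"
    using r_pos[of m] by (simp flip: scaleR_diff_right)
  finally show False by simp
qed

lemma continuous_point: "continuous_on UNIV point"
proof -
  have "uniform_limit UNIV (\<lambda>m w. \<Sum>k<m. r k *\<^sub>R e (w k mod n k)) point sequentially"
    unfolding point_def
    by (rule Weierstrass_m_test[OF _ summable_r]) (simp add: norm_e r_pos less_imp_le)
  moreover have "continuous_on UNIV (\<lambda>w :: nat \<Rightarrow> nat. r k *\<^sub>R e (w k mod n k))" for k
    by (rule continuous_on_compose2[of UNIV "\<lambda>i. r k *\<^sub>R e (i mod n k)" UNIV "\<lambda>w. w k"])
      (auto intro!: continuous_on_discrete)
  ultimately show ?thesis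
    by (intro uniform_limit_theorem[where F = sequentially])
      (auto intro!: always_eventually continuous_on_sum)
qed

lemma compact_cantor: "compact cantor"
proof -
  let ?W = "Pi\<^sub>E UNIV (\<lambda>k. {..<n k})"
  have "compactin (product_topology (\<lambda>k. euclidean) UNIV) ?W"
    unfolding compactin_PiE by (auto intro: finite_imp_compact)
  hence "compact ?W" by (simp add: euclidean_product_topology)
  hence "compact (point ` ?W)"
    by (intro compact_continuous_image continuous_on_subset[OF continuous_point]) auto
  also have "point ` ?W = cantor"
  proof -
    have "point w = point (\<lambda>k. w k mod n k)" for w by (simp add: point_def)
    moreover have "(\<lambda>k. w k mod n k) \<in> ?W" for w by auto
    ultimately show ?thesis unfolding cantor_def by blast
  qed
  finally show ?thesis .
qed

sublocale digits: product_prob_space "\<lambda>k. measure_pmf (pmf_of_set {..<n k})" UNIV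
  by (intro product_prob_spaceI) (rule prob_space_measure_pmf)

lemma sets_digits: "sets digits = sets borel"
proof -
  have "sets digits = sets (Pi\<^sub>M UNIV (\<lambda>k::nat. borel :: nat measure))"
    unfolding digits_def by (intro sets_PiM_cong) (auto simp: sets_borel_eq_count_space)
  thus ?thesis by (simp add: sets_PiM_equal_borel)
qed

lemma space_digits: "space digits = UNIV"
  using sets_eq_imp_space_eq[OF sets_digits] by simp

lemma measurable_point: "point \<in> measurable digits (restrict_space borel cantor)"
proof (rule measurable_restrict_space2)
  show "point \<in> borel_measurable digits"
    using borel_measurable_continuous_onI[OF continuous_point]
    by (simp add: measurable_cong_sets[OF sets_digits refl])
qed (auto simp: cantor_def)

lemma prob_space_cantor_measure: "prob_space cantor_measure"
  unfolding cantor_measure_def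
  using digits.prob_space_axioms measurable_point
  by (intro prob_space.prob_space_distr) (simp_all add: digits_def)

lemma sets_cantor_measure: "sets cantor_measure = sets (restrict_space borel cantor)"
  by (simp add: cantor_measure_def)

text \<open>Each cylinder of level \<open>k\<close> has measure \<open>1 / N\<^sub>k\<close>.\<close>

lemma emeasure_cylinder:
  "emeasure digits {v. \<forall>i<k. v i mod n i = w i mod n i} = ennreal (1 / (\<Prod>i<k. real (n i)))"
proof -
  have "emeasure digits {v \<in> space digits. \<forall>i\<in>{..<k}. v i \<in> {m. m mod n i = w i mod n i}}
      = (\<Prod>i<k. emeasure (measure_pmf (pmf_of_set {..<n i})) {m. m mod n i = w i mod n i})"
    unfolding digits_def by (intro digits.emeasure_PiM_Collect) auto
  also have "\<dots> = (\<Prod>i<k. ennreal (1 / real (n i)))"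
  proof (intro prod.cong refl)
    fix i
    have "{..<n i} \<inter> {m. m mod n i = w i mod n i} = {w i mod n i}" by auto
    thus "emeasure (measure_pmf (pmf_of_set {..<n i})) {m. m mod n i = w i mod n i}
        = ennreal (1 / real (n i))"
      by (subst emeasure_pmf_of_set) (auto simp: lessThan_empty_iff divide_ennreal
          ennreal_of_nat_eq_real_of_nat)
  qed
  also have "\<dots> = ennreal (1 / (\<Prod>i<k. real (n i)))"
    by (subst prod_ennreal) (auto simp: prod_dividef)
  finally show ?thesis by (simp add: space_digits Ball_def)
qed

lemma emeasure_cantor_ball:
  "emeasure cantor_measure (ball x \<epsilon> \<inter> cantor) = emeasure digits {v. dist x (point v) < \<epsilon>}"
proof -
  have "ball x \<epsilon> \<inter> cantor \<in> sets (restrict_space borel cantor)"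
    by (auto simp: sets_restrict_space Int_commute)
  moreover have "point -` (ball x \<epsilon> \<inter> cantor) \<inter> space digits = {v. dist x (point v) < \<epsilon>}"
    by (auto simp: space_digits cantor_def)
  ultimately show ?thesis
    unfolding cantor_measure_def by (simp add: emeasure_distr[OF measurable_point])
qed

lemma point_ball_in_sets: "{v. dist x (point v) < \<epsilon>} \<in> sets digits"
proof -
  have "open (point -` ball x \<epsilon>)" by (intro open_vimage open_ball continuous_point)
  thus ?thesis by (simp add: sets_digits vimage_def)
qed

lemma cylinder_in_sets: "{v. \<forall>i<k. v i mod n i = w i mod n i} \<in> sets digits"
proof (rule ccontr)
  assume "\<not> ?thesis"
  \<comment> \<open>a set outside the \<open>\<sigma>\<close>-algebra would have measure \<open>0\<close>\<close>
  hence "ennreal (1 / (\<Prod>i<k. real (n i))) = 0"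
    using emeasure_cylinder[of k w] by (simp add: emeasure_notin_sets)
  hence "1 / (\<Prod>i<k. real (n i)) \<le> 0" by (simp only: ennreal_eq_0_iff)
  moreover have "0 < 1 / (\<Prod>i<k. real (n i))" by (intro divide_pos_pos prod_pos) auto
  ultimately show False by linarith
qed

lemma cantor_mass_ge:
  assumes "x \<in> cantor" "3 * r k \<le> \<epsilon>"
  shows "ennreal (1 / (\<Prod>i<k. real (n i))) \<le> emeasure cantor_measure (ball x \<epsilon> \<inter> cantor)"
proof -
  obtain w where w: "x = point w" using assms by (auto simp: cantor_def)
  have "{v. \<forall>i<k. v i mod n i = w i mod n i} \<subseteq> {v. dist x (point v) < \<epsilon>}"
  proof clarify
    fix v assume "\<forall>i<k. v i mod n i = w i mod n i"
    hence "dist (point w) (point v) < 3 * r k" by (intro dist_point_less) simp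
    thus "dist x (point v) < \<epsilon>" using assms w by simp
  qed
  thus ?thesis
    unfolding emeasure_cantor_ball emeasure_cylinder[symmetric, of _ w]
    by (intro emeasure_mono point_ball_in_sets)
qed

lemma cantor_mass_le:
  assumes "x \<in> cantor" "\<epsilon> \<le> r k / 4"
  shows "emeasure cantor_measure (ball x \<epsilon> \<inter> cantor) \<le> ennreal (1 / (\<Prod>i<Suc k. real (n i)))"
proof -
  obtain w where w: "x = point w" using assms by (auto simp: cantor_def)
  have "{v. dist x (point v) < \<epsilon>} \<subseteq> {v. \<forall>i<Suc k. v i mod n i = w i mod n i}"
  proof clarify
    fix v i assume "dist x (point v) < \<epsilon>" "i < Suc k"
    thus "v i mod n i = w i mod n i"
      using digits_eq_of_dist_less[of w v k i] assms w by simp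
  qed
  thus ?thesis
    unfolding emeasure_cantor_ball emeasure_cylinder[symmetric, of _ w]
    by (intro emeasure_mono cylinder_in_sets)
qed

lemma frequently_at_scales:
  assumes "\<forall>\<^sub>F k in sequentially. P (c * r k)" "0 < c"
  shows "\<exists>\<^sub>F \<epsilon> in at_right 0. P \<epsilon>"
  unfolding frequently_def
proof
  assume "\<forall>\<^sub>F \<epsilon> in at_right 0. \<not> P \<epsilon>"
  moreover have "filterlim (\<lambda>k. c * r k) (at_right 0) sequentially"
    unfolding filterlim_at using r_pos r_tendsto_0 assms(2)
    by (auto intro!: always_eventually tendsto_mult_right_zero simp: less_imp_neq[symmetric])
  ultimately have "\<forall>\<^sub>F k in sequentially. \<not> P (c * r k)" by (rule eventually_compose_filterlim)
  with assms(1) have "\<forall>\<^sub>F k::nat in sequentially. False" by eventually_elim simp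
  thus False by simp
qed

lemma uniform_local_scales_cantor:
  assumes scl: "scaling scl" "0 < \<alpha>" "\<alpha> \<le> \<beta>"
    and asym:
    "\<And>\<gamma>. 0 < \<gamma> \<Longrightarrow> \<gamma> < \<alpha> \<Longrightarrow> \<forall>\<^sub>F k in sequentially. 1 / (\<Prod>i<k. real (n i)) \<le> scl \<gamma> (r k / 4)"
    "\<And>\<gamma>. \<alpha> < \<gamma> \<Longrightarrow> \<forall>\<^sub>F k in sequentially. scl \<gamma> (3 * r k) \<le> 1 / (\<Prod>i<k. real (n i))"
    "\<And>\<gamma>. \<beta> < \<gamma> \<Longrightarrow> \<forall>\<^sub>F k in sequentially. scl \<gamma> (3 * r k) \<le> 1 / (\<Prod>i<Suc k. real (n i))"
    "\<And>\<gamma>. 0 < \<gamma> \<Longrightarrow> \<gamma> < \<beta> \<Longrightarrow>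
       \<forall>\<^sub>F k in sequentially. 1 / (\<Prod>i<Suc k. real (n i)) \<le> scl \<gamma> (r k / 4)"
  shows "uniform_local_scales scl \<alpha> \<beta> cantor cantor_measure"
proof (rule uniform_local_scales.intro)
  have mono: "scl \<gamma> s \<le> scl \<gamma> t" if "0 < \<gamma>" "0 < s" "s \<le> t" for \<gamma> s t
    using hausdorff_functionD(2)[OF scaling_hausdorff_function[OF scl(1)]] that by simp
  note less_r = eventually_at_right_real[of 0]
  {
    fix \<gamma> assume \<gamma>: "0 < \<gamma>" "\<gamma> < \<alpha>"
    obtain K where K: "\<And>k. k \<ge> K \<Longrightarrow> 1 / (\<Prod>i<k. real (n i)) \<le> scl \<gamma> (r k / 4)"
      using asym(1)[OF \<gamma>] unfolding eventually_sequentially by blast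
    have "\<forall>\<^sub>F \<epsilon> in at_right 0. \<epsilon> \<in> {0<..<1 / 4 * r K}"
      using r_pos by (intro less_r) simp
    thus "\<forall>\<^sub>F \<epsilon> in at_right 0. \<forall>x\<in>cantor.
        emeasure cantor_measure (ball x \<epsilon> \<inter> cantor) \<le> ennreal (scl \<gamma> \<epsilon>)"
    proof eventually_elim
      case (elim \<epsilon>)
      then obtain k where k: "K \<le> k" "1 / 4 * r (Suc k) < \<epsilon>" "\<epsilon> \<le> 1 / 4 * r k"
        using between_scales[of \<epsilon> "1 / 4" K] by auto
      have "1 / (\<Prod>i<Suc k. real (n i)) \<le> scl \<gamma> (r (Suc k) / 4)" using K[of "Suc k"] k by simp
      also have "\<dots> \<le> scl \<gamma> \<epsilon>" using k r_pos \<gamma> by (intro mono) auto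
      finally show ?case
        using k by (auto intro: order_trans[OF cantor_mass_le ennreal_leI])
    qed
  next
    fix \<gamma> assume \<gamma>: "\<alpha> < \<gamma>"
    have "\<forall>\<^sub>F k in sequentially. \<forall>x\<in>cantor.
        ennreal (scl \<gamma> (3 * r k)) \<le> emeasure cantor_measure (ball x (3 * r k) \<inter> cantor)"
      using asym(2)[OF \<gamma>]
      by eventually_elim (auto intro: order_trans[OF ennreal_leI cantor_mass_ge])
    thus "\<exists>\<^sub>F \<epsilon> in at_right 0. \<forall>x\<in>cantor.
        ennreal (scl \<gamma> \<epsilon>) \<le> emeasure cantor_measure (ball x \<epsilon> \<inter> cantor)"
      by (rule frequently_at_scales) simp
  next
    fix \<gamma> assume \<gamma>: "\<beta> < \<gamma>"
    obtain K where K: "\<And>k. k \<ge> K \<Longrightarrow> scl \<gamma> (3 * r k) \<le> 1 / (\<Prod>i<Suc k. real (n i))"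
      using asym(3)[OF \<gamma>] unfolding eventually_sequentially by blast
    have "\<forall>\<^sub>F \<epsilon> in at_right 0. \<epsilon> \<in> {0<..<3 * r K}"
      using r_pos by (intro less_r) simp
    thus "\<forall>\<^sub>F \<epsilon> in at_right 0. \<forall>x\<in>cantor.
        ennreal (scl \<gamma> \<epsilon>) \<le> emeasure cantor_measure (ball x \<epsilon> \<inter> cantor)"
    proof eventually_elim
      case (elim \<epsilon>)
      then obtain k where k: "K \<le> k" "3 * r (Suc k) < \<epsilon>" "\<epsilon> \<le> 3 * r k"
        using between_scales[of \<epsilon> 3 K] by auto
      have "scl \<gamma> \<epsilon> \<le> scl \<gamma> (3 * r k)" using elim k \<gamma> scl by (intro mono) auto
      also have "\<dots> \<le> 1 / (\<Prod>i<Suc k. real (n i))" using K k by blast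
      finally show ?case
        using k by (auto intro: order_trans[OF ennreal_leI cantor_mass_ge] simp del: prod.lessThan_Suc)
    qed
  next
    fix \<gamma> assume \<gamma>: "0 < \<gamma>" "\<gamma> < \<beta>"
    have "\<forall>\<^sub>F k in sequentially. \<forall>x\<in>cantor.
        emeasure cantor_measure (ball x (1 / 4 * r k) \<inter> cantor) \<le> ennreal (scl \<gamma> (1 / 4 * r k))"
      using asym(4)[OF \<gamma>]
      by eventually_elim (auto intro: order_trans[OF cantor_mass_le ennreal_leI])
    thus "\<exists>\<^sub>F \<epsilon> in at_right 0. \<forall>x\<in>cantor.
        emeasure cantor_measure (ball x \<epsilon> \<inter> cantor) \<le> ennreal (scl \<gamma> \<epsilon>)"
      by (rule frequently_at_scales) simp
  }
qed (fact scl compact_cantor sets_cantor_measure prob_space_cantor_measure)+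

end


section \<open>Compact sets with prescribed Hausdorff and packing scales\<close>

theorem theorem2p2:
  fixes scl :: "real \<Rightarrow> real \<Rightarrow> real" and \<alpha> \<beta> :: real
  assumes infinite_dim: "\<not> (\<exists>B :: 'a::banach set. finite B \<and> span B = UNIV)"
    and scl: "scaling scl"
    and "0 < \<alpha>" and "\<alpha> \<le> \<beta>"
  shows "\<exists>X :: 'a set. compact X \<and>
           hausdorff_scale scl X = ennreal \<alpha> \<and> packing_scale scl X = ennreal \<beta> \<and>
           (\<exists>\<nu> :: 'a measure. sets \<nu> = sets (restrict_space borel X) \<and> prob_space \<nu> \<and>
              (AE x in \<nu>. lower_local_scale scl \<nu> x = ennreal \<alpha> \<and>
                          upper_local_scale scl \<nu> x = ennreal \<beta>))"
proof -
  obtain e :: "nat \<Rightarrow> 'a"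
    where e: "\<And>i. norm (e i) = 1" "\<And>i j. i \<noteq> j \<Longrightarrow> 1 / 2 \<le> norm (e i - e j)"
    using separated_unit_sequence[OF infinite_dim] by blast
  obtain r :: "nat \<Rightarrow> real" and n :: "nat \<Rightarrow> nat"
    where rn: "\<And>k. 0 < r k" "\<And>k. r (Suc k) \<le> r k / 100" "\<And>k. 1 \<le> n k"
    and asym:
    "\<And>\<gamma>. 0 < \<gamma> \<Longrightarrow> \<gamma> < \<alpha> \<Longrightarrow> \<forall>\<^sub>F k in sequentially. 1 / (\<Prod>i<k. real (n i)) \<le> scl \<gamma> (r k / 4)"
    "\<And>\<gamma>. \<alpha> < \<gamma> \<Longrightarrow> \<forall>\<^sub>F k in sequentially. scl \<gamma> (3 * r k) \<le> 1 / (\<Prod>i<k. real (n i))"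
    "\<And>\<gamma>. \<beta> < \<gamma> \<Longrightarrow> \<forall>\<^sub>F k in sequentially. scl \<gamma> (3 * r k) \<le> 1 / (\<Prod>i<Suc k. real (n i))"
    "\<And>\<gamma>. 0 < \<gamma> \<Longrightarrow> \<gamma> < \<beta> \<Longrightarrow>
       \<forall>\<^sub>F k in sequentially. 1 / (\<Prod>i<Suc k. real (n i)) \<le> scl \<gamma> (r k / 4)"
    by (rule cantor_parameters[OF scl \<open>0 < \<alpha>\<close> \<open>\<alpha> \<le> \<beta>\<close>]) blast
  interpret separated_cantor e r n using e rn by unfold_locales
  interpret uniform_local_scales scl \<alpha> \<beta> cantor cantor_measure
    by (rule uniform_local_scales_cantor[OF scl \<open>0 < \<alpha>\<close> \<open>\<alpha> \<le> \<beta>\<close> asym])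
  have "AE x in cantor_measure. lower_local_scale scl cantor_measure x = ennreal \<alpha> \<and>
      upper_local_scale scl cantor_measure x = ennreal \<beta>"
    by (intro AE_I2) (simp add: space_\<nu> lower_local_scale_eq upper_local_scale_eq)
  thus ?thesis
    using compact_cantor hausdorff_scale_eq packing_scale_eq sets_cantor_measure
      prob_space_cantor_measure by blast
qed
end
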